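(* Let $P\subset\mathbb R^n$ be an $n$-dimensional convex polytope with set of facet normals $N(P)$. Then $P$ is monotypic if and only if the following holds: whenever some $n+1$ normals in $N(P)$ are in conical position, their positive hull contains another normal of $P$ (i.e. an element of $N(P)$ different from these $n+1$ normals).
   Context: $N(P)$ denotes the set of outer unit normal vectors of the facets of $P$. A polytope $P$ is monotypic if every polytope $Q$ with $N(Q)=N(P)$ is combinatorially equivalent to $P$. The positive hull $\operatorname{pos}A$ of a set $A$ is the set of all nonnegative linear combinations of elements of $A$. A finite set $A\subset\mathbb R^n$ is in conical position if there is a hyperplane strictly separating $A$ from $0$ (equivalently $0\notin\operatorname{conv}A$) and no point of $A$ lies in the positive hull of the other points of $A$. *)

theory Defs
  imports "HOL-Analysis.Analysis"
begin

definition facet_normals :: "(real^'n) set \<Rightarrow> (real^'n) set" where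
  "facet_normals P = {u. norm u = 1 \<and>
     (\<exists>F b. F facet_of P \<and> P \<subseteq> {x. u \<bullet> x \<le> b} \<and> F = P \<inter> {x. u \<bullet> x = b})}"

definition comb_equiv :: "(real^'n) set \<Rightarrow> (real^'n) set \<Rightarrow> bool" where
  "comb_equiv P Q \<longleftrightarrow> (\<exists>f. bij_betw f {F. F face_of P} {G. G face_of Q} \<and>
     (\<forall>F1 F2. F1 face_of P \<longrightarrow> F2 face_of P \<longrightarrow> (F1 \<subseteq> F2 \<longleftrightarrow> f F1 \<subseteq> f F2)))"

definition monotypic :: "(real^'n) set \<Rightarrow> bool" where
  "monotypic P \<longleftrightarrow> (\<forall>Q :: (real^'n) set. polytope Q \<and> facet_normals Q = facet_normals P
      \<longrightarrow> comb_equiv P Q)"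

definition pos :: "(real^'n) set \<Rightarrow> (real^'n) set" where
  "pos A = {(\<Sum>x\<in>B. c x *\<^sub>R x) | B c. finite B \<and> B \<subseteq> A \<and> (\<forall>x\<in>B. 0 \<le> c x)}"

definition conical_position :: "(real^'n) set \<Rightarrow> bool" where
  "conical_position A \<longleftrightarrow> finite A \<and> 0 \<notin> convex hull A \<and> (\<forall>a\<in>A. a \<notin> pos (A - {a}))"

end

theory Submission
  imports Defs
begin

text \<open>Fix the set \<open>N\<close> of normals and let the right-hand side \<open>h\<close> of the inequalities \<open>u \<bullet> x \<le> h u\<close>
  vary over those for which every \<open>u \<in> N\<close> still defines a facet.

  If \<open>n + 1\<close> of the facets of such a polytope meet in a point, their normals are in conical
  position and no further normal lies in their positive hull. So under the stated condition all
  these polytopes are simple; as the admissible right-hand sides form a convex set, two of them can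
  be joined by a segment, along which no vertex can change its set of active normals, so that the
  face lattices agree.

  Conversely, if \<open>n + 1\<close> normals in conical position have no further normal in their positive hull,
  some admissible polytope has a point on all the corresponding facets, hence a vertex on more than
  \<open>n\<close> facets, whereas a generic admissible right-hand side gives a simple polytope. The number of
  facets through a vertex is an invariant of the face lattice, so these two polytopes are not
  equivalent.\<close>

section \<open>Step sizes and bounded rays\<close>

lemma finite_positive_lower_bound:
  fixes f :: "'a \<Rightarrow> real"
  assumes "finite S" "\<And>x. x \<in> S \<Longrightarrow> 0 < f x"
  shows "\<exists>e>0. \<forall>x\<in>S. e < f x"
  using assms
proof (induction S rule: finite_induct)
  case empty
  then show ?case by (intro exI[of _ 1]) auto
next
  case (insert x S)
  then obtain e where e: "e > 0" "\<forall>y\<in>S. e < f y" by auto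
  have "f x > 0" using insert by auto
  with e show ?case by (intro exI[of _ "min e (f x / 2)"]) auto
qed

lemma bounded_ray_zero:
  fixes y :: "'a::real_normed_vector"
  assumes "bounded S" "\<And>t. t \<ge> 0 \<Longrightarrow> x + t *\<^sub>R y \<in> S"
  shows "y = 0"
proof (rule ccontr)
  assume "y \<noteq> 0"
  obtain B where B: "\<And>z. z \<in> S \<Longrightarrow> norm z \<le> B" using assms(1) bounded_iff by metis
  then have n: "norm (x + t *\<^sub>R y) \<le> B" if "t \<ge> 0" for t using assms(2) that by blast
  have "norm x \<le> B" using n[of 0] by simp
  then have B0: "2 * B + 1 \<ge> 0" using norm_ge_zero[of x] by linarith
  \<comment> \<open>This makes \<open>t *\<^sub>R y\<close> longer than \<open>2 * B\<close>, which
    bounds the distance of any two points of \<open>S\<close>.\<close>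
  define t where "t = (2 * B + 1) / norm y"
  have t: "t \<ge> 0" unfolding t_def using B0 by simp
  have "2 * B + 1 = norm (t *\<^sub>R y)" using B0 \<open>y \<noteq> 0\<close> by (simp add: t_def)
  also have "\<dots> \<le> norm (x + t *\<^sub>R y) + norm x"
    by (metis add_diff_cancel_left' norm_triangle_ineq4)
  also have "\<dots> \<le> B + B" using n[OF t] \<open>norm x \<le> B\<close> by simp
  finally show False by simp
qed

section \<open>Positive hulls\<close>

text \<open>Extending the coefficients by zero gives all combinations the common index set
  \<open>A\<close>, so that they can be added termwise.\<close>

lemma pos_finite:
  assumes "finite A"
  shows "pos A = {(\<Sum>x\<in>A. c x *\<^sub>R x) | c. \<forall>x\<in>A. 0 \<le> c x}"
proof
  show "pos A \<subseteq> {(\<Sum>x\<in>A. c x *\<^sub>R x) | c. \<forall>x\<in>A. 0 \<le> c x}"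
  proof
    fix y assume "y \<in> pos A"
    then obtain B c where B: "finite B" "B \<subseteq> A" "\<forall>x\<in>B. 0 \<le> c x" "y = (\<Sum>x\<in>B. c x *\<^sub>R x)"
      unfolding pos_def by auto
    let ?d = "\<lambda>x. if x \<in> B then c x else 0"
    have "(\<Sum>x\<in>A. ?d x *\<^sub>R x) = (\<Sum>x\<in>B. ?d x *\<^sub>R x)"
      using B assms by (intro sum.mono_neutral_right) auto
    also have "\<dots> = y" unfolding B(4) by (intro sum.cong) auto
    finally have "y = (\<Sum>x\<in>A. ?d x *\<^sub>R x)" ..
    moreover have "\<forall>x\<in>A. 0 \<le> ?d x" using B by auto
    ultimately show "y \<in> {(\<Sum>x\<in>A. c x *\<^sub>R x) | c. \<forall>x\<in>A. 0 \<le> c x}"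
      unfolding mem_Collect_eq by (intro exI[of _ ?d]) (rule conjI)
  qed
  show "{(\<Sum>x\<in>A. c x *\<^sub>R x) | c. \<forall>x\<in>A. 0 \<le> c x} \<subseteq> pos A"
    unfolding pos_def using assms by blast
qed

lemma convex_cone_pos:
  assumes "finite A"
  shows "convex_cone (pos A)"
  unfolding convex_cone_iff
proof (intro conjI ballI allI impI)
  show "0 \<in> pos A" unfolding pos_def by force
next
  fix x y assume "x \<in> pos A" "y \<in> pos A"
  then obtain c d where cd: "\<forall>x\<in>A. 0 \<le> c x" "x = (\<Sum>x\<in>A. c x *\<^sub>R x)"
    "\<forall>x\<in>A. 0 \<le> d x" "y = (\<Sum>x\<in>A. d x *\<^sub>R x)"
    unfolding pos_finite[OF assms] by blast
  then have "x + y = (\<Sum>x\<in>A. (c x + d x) *\<^sub>R x)"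
    by (simp add: scaleR_left_distrib sum.distrib)
  moreover have "\<forall>x\<in>A. 0 \<le> c x + d x" using cd by auto
  ultimately show "x + y \<in> pos A"
    unfolding pos_finite[OF assms] mem_Collect_eq by (intro exI[of _ "\<lambda>x. c x + d x"]) simp
next
  fix x and k :: real assume x: "x \<in> pos A" "0 \<le> k"
  then obtain c where c: "\<forall>x\<in>A. 0 \<le> c x" "x = (\<Sum>x\<in>A. c x *\<^sub>R x)"
    unfolding pos_finite[OF assms] by blast
  then have "k *\<^sub>R x = (\<Sum>x\<in>A. (k * c x) *\<^sub>R x)"
    by (simp add: scaleR_sum_right)
  moreover have "\<forall>x\<in>A. 0 \<le> k * c x" using c x by auto
  ultimately show "k *\<^sub>R x \<in> pos A"
    unfolding pos_finite[OF assms] mem_Collect_eq by (intro exI[of _ "\<lambda>x. k * c x"]) simp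
qed

text \<open>A finitely generated cone is closed, so \<open>u\<close> can be strictly separated from
  it, and a functional bounded below on a cone is nonnegative there.\<close>

lemma farkas:
  fixes u :: "real^'n"
  assumes "finite A" "u \<notin> pos A"
  obtains y where "u \<bullet> y > 0" "\<And>v. v \<in> A \<Longrightarrow> v \<bullet> y \<le> 0"
proof -
  let ?C = "convex_cone hull A"
  have sub: "A \<subseteq> pos A"
  proof
    fix x assume "x \<in> A"
    then show "x \<in> pos A"
      unfolding pos_def mem_Collect_eq by (intro exI[of _ "{x}"] exI[of _ "\<lambda>_. 1"]) auto
  qed
  have "?C \<subseteq> pos A" by (intro hull_minimal sub convex_cone_pos assms)
  then have "u \<notin> ?C" using assms by auto
  then obtain a b where ab: "a \<bullet> u < b" "\<And>x. x \<in> ?C \<Longrightarrow> b < a \<bullet> x"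
    using separating_hyperplane_closed_point[OF convex_convex_cone_hull, of A u]
      closed_convex_cone_hull[OF assms(1)] by blast
  have b0: "b < 0" using ab(2)[OF convex_cone_hull_contains_0] by simp
  have "a \<bullet> v \<ge> 0" if "v \<in> A" for v
  proof (rule ccontr)
    assume neg: "\<not> a \<bullet> v \<ge> 0"
    \<comment> \<open>At this multiple of \<open>v\<close> the functional takes exactly the
      forbidden value \<open>b\<close>.\<close>
    have "(b / (a \<bullet> v)) *\<^sub>R v \<in> ?C"
      using neg b0 that by (intro convex_cone_hull_mul hull_inc) (auto simp: divide_nonpos_nonpos)
    from ab(2)[OF this] neg show False by simp
  qed
  with ab b0 show ?thesis
    by (intro that[of "-a"]) (auto simp: inner_commute)
qed

text \<open>As \<open>u\<close> is nonzero, some coefficient is positive, and its term makes the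
  inner product strictly negative.\<close>

lemma pos_inner_neg:
  assumes "u \<in> pos A" "u \<noteq> 0" "\<And>v. v \<in> A \<Longrightarrow> v \<bullet> d < 0"
  shows "u \<bullet> d < 0"
proof -
  obtain B c where B: "finite B" "B \<subseteq> A" "\<forall>x\<in>B. 0 \<le> c x" "u = (\<Sum>x\<in>B. c x *\<^sub>R x)"
    using assms(1) unfolding pos_def by auto
  obtain x where x: "x \<in> B" "c x \<noteq> 0"
    using B(4) assms(2) by (metis (no_types, lifting) scale_eq_0_iff sum.neutral)
  have "0 < (\<Sum>x\<in>B. c x * - (x \<bullet> d))"
  proof (rule sum_pos2[OF B(1) x(1)])
    have "c x > 0" "x \<bullet> d < 0" using x B assms(3) by force+
    then show "0 < c x * - (x \<bullet> d)" by (simp add: mult_pos_neg)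
    show "0 \<le> c y * - (y \<bullet> d)" if "y \<in> B" for y
    proof -
      have "c y \<ge> 0" "y \<bullet> d < 0" using that B assms(3) by auto
      then show ?thesis by (simp add: mult_nonneg_nonpos)
    qed
  qed
  then show ?thesis unfolding B(4) by (simp add: inner_sum_left sum_negf)
qed

lemma conical_position_neg_direction:
  fixes A :: "(real^'n) set"
  assumes "conical_position A"
  obtains w where "\<And>v. v \<in> A \<Longrightarrow> v \<bullet> w < 0"
proof -
  have "finite A" "0 \<notin> convex hull A" using assms unfolding conical_position_def by auto
  then obtain a b where "0 < b" "\<forall>x\<in>convex hull A. a \<bullet> x > b"
    using separating_hyperplane_closed_0[of "convex hull A"]
    by (metis compact_imp_closed convex_convex_hull finite_imp_compact_convex_hull)
  then have "v \<bullet> (-a) < 0" if "v \<in> A" for v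
    using hull_inc[OF that, of convex] by (force simp: inner_commute)
  then show ?thesis by (rule that)
qed

section \<open>Polytopes with prescribed facet normals\<close>

definition hpoly :: "(real^'n) set \<Rightarrow> (real^'n \<Rightarrow> real) \<Rightarrow> (real^'n) set" where
  "hpoly N h = {x. \<forall>u\<in>N. u \<bullet> x \<le> h u}"

text \<open>With \<open>tight\<close>, this forms a Galois connection between subsets of
  \<open>hpoly N h\<close> and subsets of \<open>N\<close>. On the empty set all of \<open>N\<close>
  is active, which is the value that suits the empty face.\<close>

definition active :: "(real^'n) set \<Rightarrow> (real^'n \<Rightarrow> real) \<Rightarrow> (real^'n) set \<Rightarrow> (real^'n) set" where
  "active N h F = {u \<in> N. \<forall>x\<in>F. u \<bullet> x = h u}"

definition tight :: "(real^'n) set \<Rightarrow> (real^'n \<Rightarrow> real) \<Rightarrow> (real^'n) set \<Rightarrow> (real^'n) set" where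
  "tight N h J = {x \<in> hpoly N h. \<forall>u\<in>J. u \<bullet> x = h u}"

lemma polyhedron_hpoly: "finite N \<Longrightarrow> polyhedron (hpoly N h)"
proof -
  assume "finite N"
  moreover have "hpoly N h = \<Inter> ((\<lambda>u. {x. u \<bullet> x \<le> h u}) ` N)" unfolding hpoly_def by auto
  ultimately show ?thesis by (auto intro: polyhedron_halfspace_le)
qed

text \<open>Boundedness of \<^term>\<open>hpoly N h\<close> says that the normals positively span the space,
  which does not depend on the right-hand side.\<close>

lemma bounded_hpoly_transfer:
  fixes N :: "(real^'n) set"
  assumes "finite N" "bounded (hpoly N h)" "x \<in> hpoly N h"
  shows "bounded (hpoly N g)"
proof -
  \<comment> \<open>Otherwise Farkas' lemma gives a recession direction \<open>y\<close> of
    \<open>hpoly N h\<close>, and a ray would lie in a bounded set.\<close>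
  have pos: "d \<in> pos N" for d
  proof (rule ccontr)
    assume "d \<notin> pos N"
    then obtain y where y: "d \<bullet> y > 0" "\<And>v. v \<in> N \<Longrightarrow> v \<bullet> y \<le> 0"
      using farkas[OF assms(1)] by blast
    have "x + t *\<^sub>R y \<in> hpoly N h" if "t \<ge> 0" for t
      unfolding hpoly_def mem_Collect_eq
    proof
      fix u assume "u \<in> N"
      then have "u \<bullet> x \<le> h u" "t * (u \<bullet> y) \<le> 0"
        using assms(3) y(2) that by (auto simp: hpoly_def mult_nonneg_nonpos)
      then show "u \<bullet> (x + t *\<^sub>R y) \<le> h u" by (simp add: inner_add_right)
    qed
    then have "y = 0" by (rule bounded_ray_zero[OF assms(2)])
    then show False using y(1) by simp
  qed
  \<comment> \<open>Writing \<open>d\<close> as a nonnegative combination of normals and summing the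
    inequalities bounds it, whatever \<open>g\<close> is.\<close>
  have up: "\<exists>B. \<forall>x\<in>hpoly N g. d \<bullet> x \<le> B" for d
  proof -
    obtain c where c: "\<forall>x\<in>N. 0 \<le> c x" "d = (\<Sum>x\<in>N. c x *\<^sub>R x)"
      using pos[of d] unfolding pos_finite[OF assms(1)] by blast
    have "d \<bullet> x \<le> (\<Sum>u\<in>N. c u * g u)" if "x \<in> hpoly N g" for x
      unfolding c(2) inner_sum_left using c(1) that
      by (auto simp: hpoly_def intro!: sum_mono mult_left_mono)
    then show ?thesis by blast
  qed
  obtain B where B: "\<And>d x. x \<in> hpoly N g \<Longrightarrow> d \<bullet> x \<le> B d"
    using up by metis
  have "norm x \<le> (\<Sum>i\<in>Basis. max (B i) (B (-i)))" if "x \<in> hpoly N g" for x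
  proof -
    have "norm x \<le> (\<Sum>i\<in>Basis. \<bar>x \<bullet> i\<bar>)" by (rule norm_le_l1)
    also have "\<dots> \<le> (\<Sum>i\<in>Basis. max (B i) (B (-i)))"
    proof (rule sum_mono)
      fix i :: "real^'n"
      show "\<bar>x \<bullet> i\<bar> \<le> max (B i) (B (-i))"
        using B[OF that, of i] B[OF that, of "-i"] by (auto simp: inner_commute)
    qed
    finally show ?thesis .
  qed
  then show ?thesis unfolding bounded_iff by blast
qed

text \<open>Irredundance is expressed by a point on each hyperplane that is strictly inside all
  other halfspaces. Such points can be averaged and shifted, so the condition survives convex
  combinations and small changes of \<open>h\<close>.\<close>

locale facet_system =
  fixes N :: "(real^'n) set" and h :: "real^'n \<Rightarrow> real"
  assumes finite_N: "finite N"
    and norm_N: "\<And>u. u \<in> N \<Longrightarrow> norm u = 1"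
    and bounded_hpoly: "bounded (hpoly N h)"
    and facet_point: "\<And>u. u \<in> N \<Longrightarrow> \<exists>x. u \<bullet> x = h u \<and> (\<forall>v\<in>N-{u}. v \<bullet> x < h v)"
begin

lemma N_nonempty: "N \<noteq> {}"
  using bounded_hpoly not_bounded_UNIV by (auto simp: hpoly_def)

text \<open>From a facet point of \<open>u\<close>, a short step along \<open>-u\<close> gains
  \<open>e\<close> at \<open>u\<close> and costs at most \<open>e\<close> at every other unit
  normal.\<close>

lemma interior_point: "\<exists>z. \<forall>u\<in>N. u \<bullet> z < h u"
proof -
  obtain u where u: "u \<in> N" using N_nonempty by auto
  obtain x where x: "u \<bullet> x = h u" "\<forall>v\<in>N-{u}. v \<bullet> x < h v" using facet_point[OF u] by auto
  obtain e where e: "e > 0" "\<forall>v\<in>N-{u}. e < h v - v \<bullet> x"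
    using finite_positive_lower_bound[of "N - {u}" "\<lambda>v. h v - v \<bullet> x"] finite_N x(2) by auto
  have "v \<bullet> (x - e *\<^sub>R u) < h v" if "v \<in> N" for v
  proof (cases "v = u")
    case True
    have "u \<bullet> u = 1" using norm_N[OF u] by (simp add: dot_square_norm)
    then show ?thesis using True x e by (simp add: inner_diff_right)
  next
    case False
    have "\<bar>v \<bullet> u\<bar> \<le> 1"
      using Cauchy_Schwarz_ineq2[of v u] norm_N[OF u] norm_N[OF that] by simp
    then have "e * - (v \<bullet> u) \<le> e * 1" using e(1) by (intro mult_left_mono) auto
    then show ?thesis using e(2) False that by (force simp: inner_diff_right)
  qed
  then show ?thesis by blast
qed

lemma polytope_hpoly: "polytope (hpoly N h)"
  using polytope_eq_bounded_polyhedron polyhedron_hpoly finite_N bounded_hpoly by blast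

lemma convex_hpoly: "convex (hpoly N h)"
  using polytope_hpoly polytope_imp_convex by blast

lemma bounded_hpoly_any_rhs: "bounded (hpoly N g)"
proof -
  obtain z where "\<forall>u\<in>N. u \<bullet> z < h u" using interior_point by auto
  then have "z \<in> hpoly N h" by (auto simp: hpoly_def less_imp_le)
  then show ?thesis by (rule bounded_hpoly_transfer[OF finite_N bounded_hpoly])
qed

lemma tight_face: "J \<subseteq> N \<Longrightarrow> tight N h J face_of hpoly N h"
proof -
  assume J: "J \<subseteq> N"
  have "convex (tight N h J)"
  proof -
    have "tight N h J = hpoly N h \<inter> (\<Inter>u\<in>J. {x. u \<bullet> x = h u})" unfolding tight_def by auto
    then show ?thesis by (auto intro!: convex_Int convex_INT convex_hyperplane convex_hpoly)
  qed
  moreover have "a \<in> tight N h J \<and> b \<in> tight N h J"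
    if ab: "a \<in> hpoly N h" "b \<in> hpoly N h" and x: "x \<in> tight N h J" "x \<in> open_segment a b" for a b x
  proof -
    obtain t where t: "0 < t" "t < 1" "x = (1 - t) *\<^sub>R a + t *\<^sub>R b"
      using x(2) unfolding in_segment by auto
    have "u \<bullet> a = h u \<and> u \<bullet> b = h u" if "u \<in> J" for u
    proof -
      have "u \<bullet> a \<le> h u" "u \<bullet> b \<le> h u" using ab J that by (auto simp: hpoly_def)
      \<comment> \<open>Two nonnegative slacks with positive weights sum to zero, so both
        vanish.\<close>
      moreover have "(1 - t) * (h u - u \<bullet> a) + t * (h u - u \<bullet> b) = 0"
        using x(1) that t(3) by (simp add: tight_def inner_add_right algebra_simps)
      ultimately show ?thesis using t
        by (smt (verit, ccfv_threshold) mult_nonneg_nonneg mult_pos_pos)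
    qed
    then show ?thesis using ab by (auto simp: tight_def)
  qed
  moreover have "tight N h J \<subseteq> hpoly N h" by (auto simp: tight_def)
  ultimately show ?thesis unfolding face_of_def by blast
qed

lemma tight_empty: "tight N h {} = hpoly N h"
  by (auto simp: tight_def)

text \<open>If all hyperplanes met in \<open>x\<close>, the polytope would be a cone with apex
  \<open>x\<close> and contain the ray from \<open>x\<close> through an interior point.\<close>

lemma tight_all: "tight N h N = {}"
proof (rule ccontr)
  assume "tight N h N \<noteq> {}"
  then obtain x where x: "\<forall>u\<in>N. u \<bullet> x = h u" by (auto simp: tight_def)
  obtain z where z: "\<forall>u\<in>N. u \<bullet> z < h u" using interior_point by blast
  have mem: "x + t *\<^sub>R (z - x) \<in> hpoly N h" if "t \<ge> 0" for t
    unfolding hpoly_def mem_Collect_eq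
  proof
    fix u assume "u \<in> N"
    then have "t * (u \<bullet> (z - x)) \<le> 0" using x z that
      by (intro mult_nonneg_nonpos) (auto simp: inner_diff_right less_imp_le)
    then show "u \<bullet> (x + t *\<^sub>R (z - x)) \<le> h u" using x \<open>u \<in> N\<close> by (simp add: inner_add_right)
  qed
  then have "z - x = 0" by (rule bounded_ray_zero[OF bounded_hpoly])
  then show False using x z N_nonempty by auto
qed

text \<open>A face that meets the relative interior of \<open>F\<close> contains all of
  \<open>F\<close>; this is applied to the face \<open>tight N h {u}\<close>.\<close>

lemma active_rel_interior:
  assumes "F face_of hpoly N h" "x \<in> rel_interior F" "u \<in> N" "u \<bullet> x = h u"
  shows "u \<in> active N h F"
proof -
  have FS: "F \<subseteq> hpoly N h" using assms face_of_imp_subset by blast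
  have "x \<in> F" using assms rel_interior_subset by blast
  then have "x \<in> tight N h {u}" using FS assms by (auto simp: tight_def)
  then have "F \<subseteq> tight N h {u}"
    using subset_of_face_of[OF tight_face[of "{u}"] FS] assms by blast
  then show ?thesis using assms by (auto simp: active_def tight_def)
qed

text \<open>Given \<open>y\<close> in the right-hand side and \<open>x\<close> in the relative
  interior of \<open>F\<close>, the segment from \<open>y\<close> to \<open>x\<close> can be
  prolonged beyond \<open>x\<close> inside the polytope. The face property at \<open>x\<close> then
  forces \<open>y\<close> into \<open>F\<close>.\<close>

lemma face_eq_tight:
  assumes F: "F face_of hpoly N h"
  shows "F = tight N h (active N h F)"
proof (cases "F = {}")
  case True
  then have "active N h F = N" by (auto simp: active_def)
  then show ?thesis using True tight_all by simp
next
  case False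
  have FS: "F \<subseteq> hpoly N h" using F face_of_imp_subset by blast
  have "convex F" using F face_of_imp_convex by blast
  then obtain x where x: "x \<in> rel_interior F" using False rel_interior_eq_empty by blast
  then have "x \<in> F" using rel_interior_subset by blast
  have "y \<in> F" if y: "y \<in> tight N h (active N h F)" for y
  proof (cases "y = x")
    case True
    then show ?thesis using \<open>x \<in> F\<close> by simp
  next
    case False
    define R where "R = {u\<in>N. u \<bullet> x < h u}"
    \<comment> \<open>Only normals inactive at \<open>x\<close> restrict the prolongation, and they
      have positive slack; the \<open>+ 1\<close> keeps the denominator positive.\<close>
    obtain e where e: "e > 0" "\<forall>u\<in>R. e < (h u - u \<bullet> x) / (\<bar>u \<bullet> (x - y)\<bar> + 1)"
      using finite_positive_lower_bound[of R "\<lambda>u. (h u - u \<bullet> x) / (\<bar>u \<bullet> (x - y)\<bar> + 1)"] finite_N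
      unfolding R_def by (auto simp: add_nonneg_pos)
    have w: "x + e *\<^sub>R (x - y) \<in> hpoly N h"
      unfolding hpoly_def mem_Collect_eq
    proof
      fix u assume u: "u \<in> N"
      show "u \<bullet> (x + e *\<^sub>R (x - y)) \<le> h u"
      proof (cases "u \<in> R")
        case True
        then have "e * (\<bar>u \<bullet> (x - y)\<bar> + 1) < h u - u \<bullet> x"
          using e(2) by (simp add: pos_less_divide_eq add_nonneg_pos)
        moreover have "e * (u \<bullet> (x - y)) \<le> e * (\<bar>u \<bullet> (x - y)\<bar> + 1)"
          using e(1) by (intro mult_left_mono) auto
        ultimately show ?thesis by (simp add: inner_add_right)
      next
        case False
        then have ux: "u \<bullet> x = h u" using u \<open>x \<in> F\<close> FS by (force simp: R_def hpoly_def)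
        then have "u \<bullet> y = h u"
          using active_rel_interior[OF F x u] y by (auto simp: tight_def)
        then show ?thesis using ux by (simp add: inner_add_right inner_diff_right)
      qed
    qed
    have "x \<in> open_segment y (x + e *\<^sub>R (x - y))"
      unfolding in_segment
    proof (intro conjI exI[of _ "1 / (1 + e)"])
      have "x + e *\<^sub>R (x - y) - y = (1 + e) *\<^sub>R (x - y)" by (simp add: algebra_simps)
      then show "y \<noteq> x + e *\<^sub>R (x - y)" using e(1) False by force
      have "(1 - 1 / (1 + e)) *\<^sub>R y + (1 / (1 + e)) *\<^sub>R (x + e *\<^sub>R (x - y))
        = y + (1 / (1 + e)) *\<^sub>R (x + e *\<^sub>R (x - y) - y)"
        by (simp add: scaleR_left_diff_distrib scaleR_right_diff_distrib)
      also have "\<dots> = x" unfolding \<open>x + e *\<^sub>R (x - y) - y = (1 + e) *\<^sub>R (x - y)\<close> using e(1) by simp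
      finally show "x = (1 - 1 / (1 + e)) *\<^sub>R y + (1 / (1 + e)) *\<^sub>R (x + e *\<^sub>R (x - y))" ..
    qed (use e(1) in auto)
    then show ?thesis using F w y \<open>x \<in> F\<close> unfolding face_of_def tight_def by blast
  qed
  then show ?thesis using FS by (auto simp: tight_def active_def)
qed

text \<open>A face is the convex hull of its vertices, so if all of them lay on the hyperplane of
  \<open>u\<close>, the whole face would.\<close>

lemma exists_vertex_inactive:
  assumes F: "F face_of hpoly N h" and u: "u \<in> N" "u \<notin> active N h F"
  obtains x where "x extreme_point_of hpoly N h" "x \<in> F" "u \<bullet> x \<noteq> h u"
proof -
  have FF: "compact F" "convex F"
    using F face_of_imp_compact face_of_imp_convex polytope_hpoly polytope_imp_compact polytope_imp_convex
    by metis+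
  have "\<exists>x. x extreme_point_of F \<and> u \<bullet> x \<noteq> h u"
  proof (rule ccontr)
    assume "\<not> ?thesis"
    then have "convex hull {x. x extreme_point_of F} \<subseteq> {x. u \<bullet> x = h u}"
      by (intro hull_minimal convex_hyperplane) auto
    then have "F \<subseteq> {x. u \<bullet> x = h u}" using Krein_Milman_Minkowski[OF FF] by simp
    then show False using u by (auto simp: active_def)
  qed
  then show ?thesis using that extreme_point_of_face[OF F] by blast
qed

text \<open>Along a direction \<open>d\<close> orthogonal to all active normals one could move both
  ways from \<open>x\<close>, making \<open>x\<close> a midpoint.\<close>

lemma span_active_vertex:
  assumes x: "x extreme_point_of hpoly N h"
  shows "span (active N h {x}) = UNIV"
proof (rule ccontr)
  assume "span (active N h {x}) \<noteq> UNIV"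
  then obtain d where d: "d \<noteq> 0" "\<And>u. u \<in> span (active N h {x}) \<Longrightarrow> d \<bullet> u = 0"
    using span_not_UNIV_orthogonal by blast
  have xS: "x \<in> hpoly N h" using x by (simp add: extreme_point_of_def)
  define R where "R = {u\<in>N. u \<bullet> x < h u}"
  obtain e where e: "e > 0" "\<forall>u\<in>R. e < (h u - u \<bullet> x) / (\<bar>u \<bullet> d\<bar> + 1)"
    using finite_positive_lower_bound[of R "\<lambda>u. (h u - u \<bullet> x) / (\<bar>u \<bullet> d\<bar> + 1)"] finite_N
    unfolding R_def by (auto simp: add_nonneg_pos)
  have w: "x + (s * e) *\<^sub>R d \<in> hpoly N h" if "\<bar>s\<bar> = 1" for s
    unfolding hpoly_def mem_Collect_eq
  proof
    fix u assume u: "u \<in> N"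
    show "u \<bullet> (x + (s * e) *\<^sub>R d) \<le> h u"
    proof (cases "u \<in> R")
      case True
      then have "e * (\<bar>u \<bullet> d\<bar> + 1) < h u - u \<bullet> x"
        using e(2) by (simp add: pos_less_divide_eq add_nonneg_pos)
      moreover have "s * e * (u \<bullet> d) \<le> e * \<bar>u \<bullet> d\<bar>"
        using that e(1) abs_ge_self[of "s * e * (u \<bullet> d)"] by (simp add: abs_mult)
      moreover have "e * \<bar>u \<bullet> d\<bar> \<le> e * (\<bar>u \<bullet> d\<bar> + 1)" using e(1) by simp
      ultimately show ?thesis by (simp add: inner_add_right)
    next
      case False
      then have ux: "u \<bullet> x = h u" using u xS by (force simp: R_def hpoly_def)
      then have "u \<in> active N h {x}" using u by (auto simp: active_def)
      then have "u \<bullet> d = 0" using d(2) span_base by (metis inner_commute)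
      then show ?thesis using ux by (simp add: inner_add_right)
    qed
  qed
  have "x \<in> open_segment (x + (1 * e) *\<^sub>R d) (x + (-1 * e) *\<^sub>R d)"
    unfolding in_segment
  proof (intro conjI exI[of _ "1/2"])
    have "(x + (1 * e) *\<^sub>R d) - (x + (-1 * e) *\<^sub>R d) = (2 * e) *\<^sub>R d"
      by (simp add: vec_eq_iff)
    then show "x + (1 * e) *\<^sub>R d \<noteq> x + (-1 * e) *\<^sub>R d"
      using e(1) d(1) by force
    show "x = (1 - 1/2) *\<^sub>R (x + (1 * e) *\<^sub>R d) + (1/2) *\<^sub>R (x + (-1 * e) *\<^sub>R d)"
      by (simp add: vec_eq_iff field_simps)
  qed auto
  moreover have "x + (1 * e) *\<^sub>R d \<in> hpoly N h" by (rule w) simp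
  moreover have "x + (-1 * e) *\<^sub>R d \<in> hpoly N h" by (rule w) simp
  ultimately show False using x unfolding extreme_point_of_def by blast
qed

end

text \<open>By dimension, \<open>F\<close> affinely spans the hyperplane of \<open>u\<close>, so
  this hyperplane lies in that of \<open>v\<close> and the unit vectors agree up to sign. Opposite
  signs would squeeze \<open>P\<close> into a hyperplane.\<close>

lemma facet_normal_unique:
  fixes P :: "(real^'n) set"
  assumes P: "aff_dim P = int CARD('n)" and F: "F facet_of P" "F \<subseteq> {x. u \<bullet> x = b}" "F \<subseteq> {x. v \<bullet> x = c}"
    and Pu: "P \<subseteq> {x. u \<bullet> x \<le> b}" and Pv: "P \<subseteq> {x. v \<bullet> x \<le> c}"
    and uv: "norm u = 1" "norm v = 1"
  shows "u = v"
proof -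
  have u0: "u \<noteq> 0" "u \<bullet> u = 1" "v \<bullet> v = 1" using uv by (auto simp: dot_square_norm)
  have F': "F \<noteq> {}" "aff_dim F = int CARD('n) - 1" "F \<subseteq> P"
    using F(1) P by (auto simp: facet_of_def dest: face_of_imp_subset)
  have "affine hull F \<subseteq> {x. u \<bullet> x = b}" "affine hull F \<subseteq> {x. v \<bullet> x = c}"
    by (intro hull_minimal F affine_hyperplane)+
  moreover from this have "affine hull F = {x. u \<bullet> x = b}"
    using F'(1,2) u0 by (intro affine_dim_equal) (auto simp: affine_hyperplane)
  ultimately have sub: "{x. u \<bullet> x = b} \<subseteq> {x. v \<bullet> x = c}" by blast
  obtain x where x: "x \<in> F" using F' by auto
  \<comment> \<open>The component of \<open>v\<close> orthogonal to \<open>u\<close>: it is parallel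
    to the hyperplane of \<open>u\<close>, hence also orthogonal to \<open>v\<close>, hence
    zero.\<close>
  define z where "z = v - (u \<bullet> v) *\<^sub>R u"
  have uz: "u \<bullet> z = 0" using u0 by (simp add: z_def inner_diff_right)
  have "u \<bullet> x = b" using x F by auto
  then have "x + z \<in> {x. u \<bullet> x = b}" using uz by (simp add: inner_add_right)
  then have "v \<bullet> (x + z) = c" using sub by blast
  moreover have vx: "v \<bullet> x = c" using x F by auto
  ultimately have "v \<bullet> z = 0" by (simp add: inner_add_right)
  moreover have "z \<bullet> z = v \<bullet> z - (u \<bullet> v) * (u \<bullet> z)"
    by (subst (1) z_def) (simp add: inner_diff_left)
  ultimately have "z = 0" using uz by simp
  then have v: "v = (u \<bullet> v) *\<^sub>R u" by (simp add: z_def)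
  then have "\<bar>u \<bullet> v\<bar> = 1" using uv by (metis mult.right_neutral norm_scaleR)
  moreover have "u \<bullet> v \<noteq> -1"
  proof
    assume "u \<bullet> v = -1"
    then have vu: "v = - u" using v by simp
    have "P \<subseteq> {x. u \<bullet> x = b}"
    proof
      fix y assume "y \<in> P"
      then have "u \<bullet> y \<le> b" "- (u \<bullet> y) \<le> c" using Pu Pv vu by auto
      moreover have "c = - b" using vx vu \<open>u \<bullet> x = b\<close> by simp
      ultimately show "y \<in> {x. u \<bullet> x = b}" by simp
    qed
    then have "aff_dim P \<le> int CARD('n) - 1"
      using aff_dim_subset[of P "{x. u \<bullet> x = b}"] u0 by simp
    then show False using P by simp
  qed
  ultimately have "u \<bullet> v = 1" by linarith
  then show ?thesis using v by simp
qed

section \<open>Passing between right-hand sides and polytopes with given facet normals\<close>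

context facet_system
begin

lemma aff_dim_hpoly: "aff_dim (hpoly N h) = int CARD('n)"
proof -
  let ?I = "\<Inter>u\<in>N. {x. u \<bullet> x < h u}"
  have "open ?I" using finite_N by (intro open_INT) (auto intro: open_halfspace_lt)
  moreover have "?I \<subseteq> hpoly N h" by (auto simp: hpoly_def less_imp_le)
  moreover have "?I \<noteq> {}" using interior_point by auto
  ultimately have "interior (hpoly N h) \<noteq> {}"
    using interior_maximal by blast
  then show ?thesis using aff_dim_nonempty_interior by fastforce
qed

text \<open>Near its facet point the hyperplane of \<open>u\<close> stays inside the polytope, and a
  nonempty relatively open piece has the dimension of the hyperplane.\<close>

lemma tight_facet:
  assumes u: "u \<in> N"
  shows "tight N h {u} facet_of hpoly N h"
proof -
  obtain x where x: "u \<bullet> x = h u" "\<forall>v\<in>N-{u}. v \<bullet> x < h v" using facet_point[OF u] by auto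
  let ?I = "\<Inter>v\<in>N-{u}. {x. v \<bullet> x < h v}" and ?H = "{x. u \<bullet> x = h u}"
  have I: "open ?I" using finite_N by (intro open_INT) (auto intro: open_halfspace_lt)
  have "u \<noteq> 0" using norm_N[OF u] by auto
  have xHI: "x \<in> ?H \<inter> ?I" using x by auto
  have sub: "?H \<inter> ?I \<subseteq> tight N h {u}" by (auto simp: tight_def hpoly_def) (metis DiffI less_eq_real_def singletonD)
  have ne: "?H \<inter> ?I \<noteq> {}" using xHI by blast
  have "aff_dim (affine hull (?H \<inter> ?I)) = aff_dim (affine hull ?H)"
    by (rule arg_cong[OF affine_hull_affine_Int_open[OF affine_hyperplane I ne]])
  then have "aff_dim (?H \<inter> ?I) = aff_dim ?H" unfolding aff_dim_affine_hull .
  then have "aff_dim ?H \<le> aff_dim (tight N h {u})" using aff_dim_subset[OF sub] by simp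
  moreover have "aff_dim (tight N h {u}) \<le> aff_dim ?H"
    by (rule aff_dim_subset) (auto simp: tight_def)
  ultimately have "aff_dim (tight N h {u}) = int CARD('n) - 1" using \<open>u \<noteq> 0\<close> by simp
  moreover have "tight N h {u} \<noteq> {}" using xHI sub by blast
  ultimately show ?thesis using tight_face[of "{u}"] u
    unfolding facet_of_def aff_dim_hpoly by simp
qed

lemma facet_normals_hpoly: "facet_normals (hpoly N h) = N"
proof
  show "N \<subseteq> facet_normals (hpoly N h)"
  proof
    fix u assume u: "u \<in> N"
    have "tight N h {u} = hpoly N h \<inter> {x. u \<bullet> x = h u}" by (auto simp: tight_def)
    moreover have "hpoly N h \<subseteq> {x. u \<bullet> x \<le> h u}" using u by (auto simp: hpoly_def)
    ultimately show "u \<in> facet_normals (hpoly N h)"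
      using tight_facet[OF u] norm_N[OF u] unfolding facet_normals_def by blast
  qed
  show "facet_normals (hpoly N h) \<subseteq> N"
  proof
    fix v assume "v \<in> facet_normals (hpoly N h)"
    then obtain F b where v: "norm v = 1" "F facet_of hpoly N h" "hpoly N h \<subseteq> {x. v \<bullet> x \<le> b}"
      "F = hpoly N h \<inter> {x. v \<bullet> x = b}" unfolding facet_normals_def by blast
    have F: "F face_of hpoly N h" "F \<noteq> hpoly N h" using v(2) by (auto simp: facet_of_def)
    \<comment> \<open>A proper face lies on the hyperplane of some \<open>u\<close> in
      \<open>N\<close>; uniqueness of facet normals then identifies \<open>v\<close> with
      \<open>u\<close>.\<close>
    then have "active N h F \<noteq> {}" using face_eq_tight[OF F(1)] tight_empty by auto
    then obtain u where u: "u \<in> N" "F \<subseteq> {x. u \<bullet> x = h u}" by (auto simp: active_def)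
    have "hpoly N h \<subseteq> {x. u \<bullet> x \<le> h u}" using u by (auto simp: hpoly_def)
    then have "v = u"
      using facet_normal_unique[OF aff_dim_hpoly v(2) _ u(2) v(3)] v u norm_N by blast
    then show "v \<in> N" using u by simp
  qed
qed

end

text \<open>In a minimal description of \<open>P\<close> by halfspaces each bounding hyperplane cuts
  out a facet, so after normalization it is one of the inequalities given by
  \<open>facet_normals P\<close>.\<close>

lemma facet_system_facet_normals:
  fixes P :: "(real^'n) set"
  assumes P: "polytope P" "aff_dim P = int CARD('n)"
  obtains h where "facet_system (facet_normals P) h" "P = hpoly (facet_normals P) h"
proof -
  let ?N = "facet_normals P"
  let ?ok = "\<lambda>u b. P \<subseteq> {x. u \<bullet> x \<le> b} \<and> P \<inter> {x. u \<bullet> x = b} facet_of P"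
  define h where "h u = (SOME b. ?ok u b)" for u
  have h: "?ok u (h u)" if "u \<in> ?N" for u
    unfolding h_def by (rule someI_ex) (use that in \<open>auto simp: facet_normals_def\<close>)
  have N1: "norm u = 1" if "u \<in> ?N" for u using that by (auto simp: facet_normals_def)
  have ok_unique: "b = c" if "?ok u b" "?ok u c" for u b c
  proof -
    have "P \<inter> {x. u \<bullet> x = b} \<noteq> {}" "P \<inter> {x. u \<bullet> x = c} \<noteq> {}"
      using that by (auto simp: facet_of_def)
    then obtain x y where "x \<in> P" "u \<bullet> x = b" "y \<in> P" "u \<bullet> y = c" by blast
    then have "b \<le> c" "c \<le> b" using that by auto
    then show ?thesis by simp
  qed
  have poly: "polyhedron P" and cvx: "convex P"
    using P polytope_imp_polyhedron polytope_imp_convex by auto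
  have inj: "u = v" if "u \<in> ?N" "v \<in> ?N" "P \<inter> {x. u \<bullet> x = h u} \<subseteq> {x. v \<bullet> x = h v}" for u v
    using facet_normal_unique[OF P(2), of "P \<inter> {x. u \<bullet> x = h u}" u "h u" v "h v"] h N1 that by blast
  \<comment> \<open>Distinct normals have distinct facets, and a polyhedron has only finitely
    many.\<close>
  have fin: "finite ?N"
  proof (rule finite_imageD)
    show "finite ((\<lambda>u. P \<inter> {x. u \<bullet> x = h u}) ` ?N)"
      by (rule finite_subset[OF _ finite_polyhedron_facets[OF poly]]) (use h in auto)
    show "inj_on (\<lambda>u. P \<inter> {x. u \<bullet> x = h u}) ?N"
    proof (rule inj_onI)
      fix u v assume *: "u \<in> ?N" "v \<in> ?N" "P \<inter> {x. u \<bullet> x = h u} = P \<inter> {x. v \<bullet> x = h v}"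
      show "u = v" by (rule inj[OF *(1,2)]) (use *(3) in blast)
    qed
  qed
  have eq: "P = hpoly ?N h"
  proof
    show "P \<subseteq> hpoly ?N h" using h by (auto simp: hpoly_def)
    have aff: "affine hull P = UNIV" using P(2) aff_dim_eq_full[of P] by simp
    obtain H where H: "finite H" "P = affine hull P \<inter> \<Inter>H"
      "\<forall>h \<in> H. \<exists>a b. a \<noteq> 0 \<and> h = {x. a \<bullet> x \<le> b}"
      "\<forall>F'. F' \<subset> H \<longrightarrow> P \<subset> (affine hull P) \<inter> \<Inter>F'"
      using polyhedron_Int_affine_minimal[of P] poly by blast
    obtain a b where ab: "\<And>h. h \<in> H \<Longrightarrow> a h \<noteq> 0 \<and> h = {x. a h \<bullet> x \<le> b h}"
      using H(3) by metis
    have facet: "P \<inter> {x. a k \<bullet> x = b k} facet_of P" if "k \<in> H" for k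
      using facet_of_polyhedron_explicit[OF H(1,2) ab] H(4) that by blast
    show "hpoly ?N h \<subseteq> P"
    proof
      fix x assume x: "x \<in> hpoly ?N h"
      have "x \<in> k" if k: "k \<in> H" for k
      proof -
        define n where "n = norm (a k)"
        define u where "u = a k /\<^sub>R n"
        have n: "n > 0" using ab[OF k] by (auto simp: n_def)
        have ak: "a k = n *\<^sub>R u" using n by (simp add: u_def)
        have *: "{x. a k \<bullet> x = b k} = {x. u \<bullet> x = b k / n}" "{x. a k \<bullet> x \<le> b k} = {x. u \<bullet> x \<le> b k / n}"
          unfolding ak using n by (auto simp: field_simps)
        have "P \<subseteq> {x. a k \<bullet> x \<le> b k}" using ab[OF k] H(2) k by blast
        then have ok: "?ok u (b k / n)" using facet[OF k] unfolding * by auto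
        have "norm u = 1" using n by (simp add: u_def n_def)
        then have u: "u \<in> ?N" using ok unfolding facet_normals_def by blast
        have "h u = b k / n" by (rule ok_unique[OF h[OF u] ok])
        then have "x \<in> {x. u \<bullet> x \<le> b k / n}" using x u by (auto simp: hpoly_def)
        then show "x \<in> k" using ab[OF k] * by blast
      qed
      then show "x \<in> P" using H(2) aff by auto
    qed
  qed
  have "facet_system ?N h"
  proof
    show "finite ?N" by fact
    show "bounded (hpoly ?N h)" using eq P polytope_imp_bounded by auto
    show "norm u = 1" if "u \<in> ?N" for u using N1 that .
    fix u assume u: "u \<in> ?N"
    let ?F = "P \<inter> {x. u \<bullet> x = h u}"
    have F: "?F \<noteq> {}" "convex ?F" using h[OF u] by (auto simp: facet_of_def face_of_imp_convex)
    \<comment> \<open>A relative interior point of the facet serves as facet point: on another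
      hyperplane it would drag the whole facet along, contradicting \<open>inj\<close>.\<close>
    then obtain x where x: "x \<in> rel_interior ?F" using rel_interior_eq_empty by blast
    then have xF: "x \<in> ?F" using rel_interior_subset by blast
    have "v \<bullet> x < h v" if v: "v \<in> ?N - {u}" for v
    proof (rule ccontr)
      assume "\<not> v \<bullet> x < h v"
      moreover have "v \<bullet> x \<le> h v" using h v xF by auto
      ultimately have "x \<in> P \<inter> {x. v \<bullet> x = h v}" using xF by simp
      moreover have "(P \<inter> {x. v \<bullet> x = h v}) face_of P" using h[of v] v by (auto simp: facet_of_def)
      ultimately have "?F \<subseteq> P \<inter> {x. v \<bullet> x = h v}"
        using subset_of_face_of[of "P \<inter> {x. v \<bullet> x = h v}" P ?F] x by blast
      then have "?F \<subseteq> {x. v \<bullet> x = h v}" by blast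
      then show False using inj[OF u, of v] v by auto
    qed
    then show "\<exists>x. u \<bullet> x = h u \<and> (\<forall>v\<in>?N-{u}. v \<bullet> x < h v)" using xF by blast
  qed
  then show ?thesis using that eq by blast
qed

text \<open>A facet of a lower-dimensional polytope has infinitely many unit normals in the sense of
  \<^const>\<open>facet_normals\<close>: tilt one of them along a normal of a hyperplane containing the polytope.\<close>

lemma aff_dim_eq_if_finite_facet_normals:
  fixes Q :: "(real^'n) set"
  assumes "finite (facet_normals Q)" "facet_normals Q \<noteq> {}"
  shows "aff_dim Q = int CARD('n)"
proof (rule ccontr)
  assume "aff_dim Q \<noteq> int CARD('n)"
  then have "aff_dim Q < DIM(real^'n)" using aff_dim_le_DIM[of Q] by simp
  then obtain a c where a: "a \<noteq> 0" "Q \<subseteq> {x. a \<bullet> x = c}" by (rule aff_lowdim_subset_hyperplane)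
  obtain u F b where u: "norm u = 1" "F facet_of Q" "Q \<subseteq> {x. u \<bullet> x \<le> b}" "F = Q \<inter> {x. u \<bullet> x = b}"
    using assms(2) unfolding facet_normals_def by blast
  have F: "F \<noteq> {}" "F \<noteq> Q" using u(2) by (auto simp: facet_of_def)
  \<comment> \<open>A multiple of \<open>a\<close> is constant on \<open>Q\<close> and could only
    cut out the empty set or \<open>Q\<close> itself.\<close>
  have indep: "u \<noteq> s *\<^sub>R a" for s
  proof
    assume us: "u = s *\<^sub>R a"
    have "u \<bullet> x = s * c" if "x \<in> Q" for x using that a by (auto simp: us)
    then have "F = {} \<or> F = Q" unfolding u(4) by auto
    then show False using F by simp
  qed
  define w where "w t = u + t *\<^sub>R a" for t
  have w0: "w t \<noteq> 0" for t
    using indep[of "- t"] by (auto simp: w_def add_eq_0_iff)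
  have "w t /\<^sub>R norm (w t) \<in> facet_normals Q" for t
  proof -
    define n where "n = norm (w t)"
    have n: "n > 0" using w0 by (simp add: n_def)
    \<comment> \<open>On \<open>Q\<close> the tilt adds only the constant \<open>t * c\<close>, so
      the same facet is cut out.\<close>
    have wx: "(w t /\<^sub>R n) \<bullet> x = (u \<bullet> x + t * c) / n" if "x \<in> Q" for x
      using that a n by (auto simp: w_def inner_add_left field_simps)
    have "Q \<subseteq> {x. (w t /\<^sub>R n) \<bullet> x \<le> (b + t * c) / n}"
      using wx u(3) n by (auto simp: divide_right_mono)
    moreover have "F = Q \<inter> {x. (w t /\<^sub>R n) \<bullet> x = (b + t * c) / n}"
      using wx u(4) n by auto
    moreover have "norm (w t /\<^sub>R n) = 1" using n by (simp add: n_def)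
    ultimately show ?thesis using u(2) unfolding facet_normals_def n_def by blast
  qed
  then have "range (\<lambda>t. w t /\<^sub>R norm (w t)) \<subseteq> facet_normals Q" by auto
  then have "finite (range (\<lambda>t. w t /\<^sub>R norm (w t)))" using assms(1) finite_subset by blast
  moreover have "inj (\<lambda>t. w t /\<^sub>R norm (w t))"
  proof (rule injI)
    fix s t assume eq: "w s /\<^sub>R norm (w s) = w t /\<^sub>R norm (w t)"
    define k where "k = norm (w s) / norm (w t)"
    have "norm (w s) *\<^sub>R (w s /\<^sub>R norm (w s)) = norm (w s) *\<^sub>R (w t /\<^sub>R norm (w t))"
      using eq by simp
    then have "w s = k *\<^sub>R w t" using w0 by (simp add: k_def divide_inverse)
    then have *: "(1 - k) *\<^sub>R u = (k * t - s) *\<^sub>R a"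
      unfolding w_def by (simp add: algebra_simps)
    have "k = 1"
    proof (rule ccontr)
      assume "k \<noteq> 1"
      then have "u = (1 / (1 - k)) *\<^sub>R ((1 - k) *\<^sub>R u)" by simp
      also have "\<dots> = ((k * t - s) / (1 - k)) *\<^sub>R a" unfolding * by simp
      finally show False using indep by blast
    qed
    then show "s = t" using * a by simp
  qed
  ultimately show False using finite_imageD infinite_UNIV_char_0 by blast
qed

text \<open>A face is determined by its active set, with inclusions reversed. Sending
  \<open>F\<close> to the face for \<open>g\<close> with the same active normals is therefore an
  isomorphism, provided that no further normal becomes active on the image.\<close>

lemma comb_equiv_if_same_active_sets:
  fixes N :: "(real^'n) set"
  assumes "facet_system N h" "facet_system N g"
    and hg: "\<And>x. x extreme_point_of hpoly N h \<Longrightarrow> \<exists>y\<in>hpoly N g. active N g {y} = active N h {x}"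
    and gh: "\<And>x. x extreme_point_of hpoly N g \<Longrightarrow> \<exists>y\<in>hpoly N h. active N h {y} = active N g {x}"
  shows "comb_equiv (hpoly N h) (hpoly N g)"
proof -
  \<comment> \<open>A normal \<open>u\<close> inactive on \<open>F\<close> is inactive at some
    vertex of \<open>F\<close>; the partner of this vertex lies in the image and is off the
    hyperplane of \<open>u\<close>. The claim is general in \<open>h\<close> and \<open>g\<close>
    because both directions use it.\<close>
  have active: "active N g (tight N g (active N h F)) = active N h F"
    if sys: "facet_system N h" "facet_system N g" and F: "F face_of hpoly N h"
      and ver: "\<And>x. x extreme_point_of hpoly N h \<Longrightarrow> \<exists>y\<in>hpoly N g. active N g {y} = active N h {x}"
    for h g :: "real^'n \<Rightarrow> real" and F
  proof
    show "active N h F \<subseteq> active N g (tight N g (active N h F))" by (auto simp: active_def tight_def)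
    show "active N g (tight N g (active N h F)) \<subseteq> active N h F"
    proof
      fix u assume u: "u \<in> active N g (tight N g (active N h F))"
      show "u \<in> active N h F"
      proof (rule ccontr)
        assume nu: "u \<notin> active N h F"
        have uN: "u \<in> N" using u by (simp add: active_def)
        obtain x where x: "x extreme_point_of hpoly N h" "x \<in> F" "u \<bullet> x \<noteq> h u"
          using facet_system.exists_vertex_inactive[OF sys(1) F uN nu] .
        obtain y where y: "y \<in> hpoly N g" "active N g {y} = active N h {x}" using ver[OF x(1)] by blast
        have "y \<in> tight N g (active N h F)"
          unfolding tight_def
        proof (intro CollectI conjI ballI)
          fix v assume "v \<in> active N h F"
          then have "v \<in> active N h {x}" using x(2) by (auto simp: active_def)
          then show "v \<bullet> y = g v" unfolding y(2)[symmetric] by (auto simp: active_def)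
        qed (rule y(1))
        then have "u \<in> active N g {y}" using u by (auto simp: active_def)
        then show False using x(3) unfolding y(2) by (auto simp: active_def)
      qed
    qed
  qed
  define f where "f F = tight N g (active N h F)" for F
  have mono: "tight N g' I \<subseteq> tight N g' J" if "J \<subseteq> I" for g' I J
    using that by (auto simp: tight_def)
  have anti: "active N g' F \<subseteq> active N g' G" if "G \<subseteq> F" for g' F G
    using that by (auto simp: active_def)
  have actN: "active N g' F \<subseteq> N" for g' F by (auto simp: active_def)
  have act: "active N g (f F) = active N h F" if "F face_of hpoly N h" for F
    unfolding f_def using active[OF assms(1,2) that hg] .
  have "bij_betw f {F. F face_of hpoly N h} {G. G face_of hpoly N g}"
    unfolding bij_betw_def
  proof
    show "inj_on f {F. F face_of hpoly N h}"
      by (rule inj_onI) (metis act facet_system.face_eq_tight[OF assms(1)] mem_Collect_eq)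
    show "f ` {F. F face_of hpoly N h} = {G. G face_of hpoly N g}"
    proof
      show "f ` {F. F face_of hpoly N h} \<subseteq> {G. G face_of hpoly N g}"
        unfolding f_def using facet_system.tight_face[OF assms(2) actN] by auto
      show "{G. G face_of hpoly N g} \<subseteq> f ` {F. F face_of hpoly N h}"
      proof
        fix G assume "G \<in> {G. G face_of hpoly N g}"
        then have G: "G face_of hpoly N g" by simp
        have "f (tight N h (active N g G)) = G"
        proof -
          have "active N h (tight N h (active N g G)) = active N g G"
            using active[OF assms(2,1) G] gh by blast
          then show ?thesis
            unfolding f_def using facet_system.face_eq_tight[OF assms(2) G] by metis
        qed
        moreover have "tight N h (active N g G) face_of hpoly N h"
          by (rule facet_system.tight_face[OF assms(1) actN])
        ultimately show "G \<in> f ` {F. F face_of hpoly N h}" by blast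
      qed
    qed
  qed
  moreover have "F1 \<subseteq> F2 \<longleftrightarrow> f F1 \<subseteq> f F2"
    if F: "F1 face_of hpoly N h" "F2 face_of hpoly N h" for F1 F2
  proof
    assume "F1 \<subseteq> F2"
    then show "f F1 \<subseteq> f F2" unfolding f_def by (intro mono anti)
  next
    assume "f F1 \<subseteq> f F2"
    then have "active N h F2 \<subseteq> active N h F1" using anti act F by metis
    then show "F1 \<subseteq> F2"
      using mono facet_system.face_eq_tight[OF assms(1)] F by metis
  qed
  ultimately show ?thesis unfolding comb_equiv_def by blast
qed

section \<open>Simplicity and the positive hull condition\<close>

context facet_system
begin

text \<open>Going from \<open>x\<close> to the facet point of \<open>u\<close> strictly decreases
  every normal in \<open>A\<close>. It would then decrease \<open>u\<close> as well, whereas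
  \<open>u\<close> attains its maximum at that point.\<close>

lemma active_not_in_pos:
  assumes x: "x \<in> hpoly N h" and u: "u \<in> N" and A: "A \<subseteq> active N h {x} - {u}"
  shows "u \<notin> pos A"
proof
  assume "u \<in> pos A"
  obtain y where y: "u \<bullet> y = h u" "\<forall>v\<in>N-{u}. v \<bullet> y < h v" using facet_point[OF u] by auto
  have "v \<bullet> (y - x) < 0" if "v \<in> A" for v
  proof -
    have "v \<in> N - {u}" "v \<bullet> x = h v" using that A by (auto simp: active_def)
    then show ?thesis using y by (simp add: inner_diff_right)
  qed
  moreover have "u \<noteq> 0" using norm_N[OF u] by auto
  ultimately have "u \<bullet> (y - x) < 0" using pos_inner_neg[OF \<open>u \<in> pos A\<close>] by blast
  then show False using x u y(1) by (auto simp: hpoly_def inner_diff_right)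
qed

lemma conical_position_active:
  assumes x: "x \<in> hpoly N h" and A: "A \<subseteq> active N h {x}"
  shows "conical_position A"
  unfolding conical_position_def
proof (intro conjI ballI)
  have AN: "A \<subseteq> N" using A by (auto simp: active_def)
  then show "finite A" using finite_N finite_subset by blast
  obtain z where z: "\<forall>u\<in>N. u \<bullet> z < h u" using interior_point by auto
  have "A \<subseteq> {v. (z - x) \<bullet> v < 0}"
  proof
    fix v assume "v \<in> A"
    then have "v \<bullet> z < h v" "v \<bullet> x = h v" using A z by (auto simp: active_def)
    then show "v \<in> {v. (z - x) \<bullet> v < 0}" by (simp add: inner_diff_left inner_diff_right inner_commute)
  qed
  then have "convex hull A \<subseteq> {v. (z - x) \<bullet> v < 0}"
    by (intro hull_minimal convex_halfspace_lt)
  then show "0 \<notin> convex hull A" by auto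
  show "a \<notin> pos (A - {a})" if "a \<in> A" for a
    using that AN A by (intro active_not_in_pos[OF x]) auto
qed

lemma card_active_le:
  assumes cond: "\<forall>A. A \<subseteq> N \<and> card A = CARD('n) + 1 \<and> conical_position A
       \<longrightarrow> (\<exists>u \<in> N - A. u \<in> pos A)"
    and x: "x \<in> hpoly N h"
  shows "card (active N h {x}) \<le> CARD('n)"
proof (rule ccontr)
  assume "\<not> ?thesis"
  then obtain A where A: "A \<subseteq> active N h {x}" "card A = CARD('n) + 1"
    using obtain_subset_with_card_n[of "CARD('n) + 1" "active N h {x}"] by auto
  have "A \<subseteq> N" using A by (auto simp: active_def)
  then obtain u where u: "u \<in> N - A" "u \<in> pos A"
    using cond A conical_position_active[OF x A(1)] by blast
  then show False using active_not_in_pos[OF x, of u A] A(1) by blast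
qed

lemma facet_system_convex_combination:
  assumes g: "facet_system N g" and t: "0 \<le> t" "t \<le> 1"
  shows "facet_system N (\<lambda>u. (1 - t) * h u + t * g u)"
proof
  show "bounded (hpoly N (\<lambda>u. (1 - t) * h u + t * g u))" by (rule bounded_hpoly_any_rhs)
  fix u assume u: "u \<in> N"
  obtain x where x: "u \<bullet> x = h u" "\<forall>v\<in>N-{u}. v \<bullet> x < h v" using facet_point[OF u] by auto
  obtain y where y: "u \<bullet> y = g u" "\<forall>v\<in>N-{u}. v \<bullet> y < g v"
    using facet_system.facet_point[OF g u] by auto
  have "v \<bullet> ((1 - t) *\<^sub>R x + t *\<^sub>R y) < (1 - t) * h v + t * g v" if "v \<in> N - {u}" for v
  \<comment> \<open>For \<open>t < 1\<close> the strict inequality comes from \<open>h\<close>; at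
    \<open>t = 1\<close> its weight is zero and \<open>g\<close> has to supply it.\<close>
  proof (cases "t = 1")
    case True
    then show ?thesis using y that by simp
  next
    case False
    then have "(1 - t) * (v \<bullet> x) < (1 - t) * h v" "t * (v \<bullet> y) \<le> t * g v"
      using x y that t by (auto intro!: mult_left_mono simp: less_imp_le)
    then show ?thesis by (simp add: inner_add_right)
  qed
  then show "\<exists>x. u \<bullet> x = (1 - t) * h u + t * g u \<and> (\<forall>v\<in>N-{u}. v \<bullet> x < (1 - t) * h v + t * g v)"
    using x(1) y(1) by (intro exI[of _ "(1 - t) *\<^sub>R x + t *\<^sub>R y"]) (simp add: inner_add_right)
qed (use finite_N norm_N in auto)

lemma finite_active: "finite (active N h F)"
  using finite_N finite_subset by (auto simp: active_def)

text \<open>Moving linearly from \<open>h\<close> to \<open>g\<close>, the intersection point of the hyperplanes through a vertex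
  could only leave the polytope through a further hyperplane, and at that moment more than
  \<open>n\<close> of them would meet.\<close>

lemma active_set_persists:
  assumes simple: "\<And>g x. facet_system N g \<Longrightarrow> x \<in> hpoly N g \<Longrightarrow> card (active N g {x}) \<le> CARD('n)"
    and g: "facet_system N g" and x: "x extreme_point_of hpoly N h"
  shows "\<exists>y\<in>hpoly N g. active N g {y} = active N h {x}"
proof -
  define A where "A = active N h {x}"
  have AN: "A \<subseteq> N" by (auto simp: A_def active_def)
  have xS: "x \<in> hpoly N h" using x by (simp add: extreme_point_of_def)
  have finA: "finite A" unfolding A_def by (rule finite_active)
  have spanA: "span A = UNIV" unfolding A_def by (rule span_active_vertex[OF x])
  have "card A \<le> CARD('n)" unfolding A_def by (rule simple[OF facet_system_axioms xS])
  \<comment> \<open>At most \<open>n\<close> vectors spanning the space form a basis, so the values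
    of \<open>g\<close> on \<open>A\<close> can be prescribed freely.\<close>
  then have indA: "independent A"
    by (intro card_le_dim_spanning[of A UNIV]) (use spanA finA in auto)
  then have cardA: "card A = CARD('n)"
    using dim_span_eq_card_independent[OF indA] spanA by simp
  obtain f :: "real^'n \<Rightarrow> real" where f: "linear f" "\<forall>u\<in>A. f u = g u"
    using linear_independent_extend[OF indA] by blast
  \<comment> \<open>The vector representing the functional \<open>f\<close>, that is, the common
    point of the hyperplanes for \<open>g\<close> with normals in \<open>A\<close>.\<close>
  define y where "y = adjoint f 1"
  have y: "u \<bullet> y = g u" if "u \<in> A" for u
    using adjoint_works[OF f(1), of u 1] f(2) that by (simp add: y_def)
  \<comment> \<open>Slacks at the two ends; at time \<open>t\<close> on the segment the slack of
    \<open>v\<close> is \<open>(1 - t) * p v + t * q v\<close>.\<close>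
  define p q where "p v = h v - v \<bullet> x" and "q v = g v - v \<bullet> y" for v
  have pA: "p v = 0" "q v = 0" if "v \<in> A" for v
    using that y by (auto simp: p_def q_def A_def active_def)
  have p: "p v > 0" if "v \<in> N - A" for v
  proof -
    have "v \<bullet> x \<le> h v" "v \<bullet> x \<noteq> h v" using that xS by (auto simp: A_def active_def hpoly_def)
    then show ?thesis by (simp add: p_def)
  qed
  \<comment> \<open>Zero slack is included, since it too would change the active set.\<close>
  define B where "B = {v\<in>N - A. q v \<le> 0}"
  have "B = {}"
  proof (rule ccontr)
    assume "B \<noteq> {}"
    have finB: "finite B" using finite_N by (auto simp: B_def)
    \<comment> \<open>The time at which the slack of \<open>v\<close> vanishes; the minimum over
      \<open>B\<close> is the first collision.\<close>
    define s where "s v = p v / (p v - q v)" for v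
    have "Min (s ` B) \<in> s ` B" using \<open>B \<noteq> {}\<close> finB by (intro Min_in) auto
    then obtain v where v: "v \<in> B" "s v = Min (s ` B)" by auto
    have smin: "s v \<le> s w" if "w \<in> B" for w using that finB v(2) by simp
    define t where "t = s v"
    have t: "0 \<le> t" "t \<le> 1"
      using p[of v] v(1) by (auto simp: t_def s_def B_def divide_le_eq intro!: divide_nonneg_nonneg)
    let ?z = "(1 - t) *\<^sub>R x + t *\<^sub>R y" and ?k = "\<lambda>u. (1 - t) * h u + t * g u"
    have k: "?k w - w \<bullet> ?z = p w - t * (p w - q w)" for w
      by (simp add: p_def q_def inner_add_right algebra_simps)
    have "p w - t * (p w - q w) \<ge> 0" if w: "w \<in> N" for w
    proof (cases "w \<in> B")
      case True
      then have pos: "p w - q w > 0" using p[of w] by (auto simp: B_def)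
      then have "t * (p w - q w) \<le> s w * (p w - q w)"
        using smin[OF True] by (intro mult_right_mono) (auto simp: t_def)
      also have "\<dots> = p w" using pos by (simp add: s_def)
      finally show ?thesis by simp
    next
      case False
      then have "p w \<ge> 0" "q w \<ge> 0" using w p[of w] pA[of w] by (cases "w \<in> A"; auto simp: B_def)+
      then have "(1 - t) * p w + t * q w \<ge> 0" using t by simp
      then show ?thesis by (simp add: algebra_simps)
    qed
    then have zS: "?z \<in> hpoly N ?k" unfolding hpoly_def using k by (smt (verit) mem_Collect_eq)
    have "p v - q v > 0" using v(1) p[of v] by (auto simp: B_def)
    then have "p v - t * (p v - q v) = 0" by (simp add: t_def s_def)
    then have "v \<bullet> ?z = ?k v" using k[of v] by simp
    moreover have "w \<bullet> ?z = ?k w" if "w \<in> A" for w using k[of w] pA[OF that] by simp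
    ultimately have sub: "insert v A \<subseteq> active N ?k {?z}"
      using AN v(1) by (auto simp: active_def B_def)
    have sys: "facet_system N ?k" by (rule facet_system_convex_combination[OF g t])
    have "card (insert v A) \<le> CARD('n)"
      using card_mono[OF facet_system.finite_active[OF sys] sub] simple[OF sys zS] by linarith
    moreover have "v \<notin> A" using v(1) by (auto simp: B_def)
    ultimately show False using finA cardA by simp
  qed
  then have q: "q v > 0" if "v \<in> N - A" for v using that by (force simp: B_def)
  have "y \<in> hpoly N g"
    unfolding hpoly_def mem_Collect_eq
  proof
    fix v assume "v \<in> N"
    then show "v \<bullet> y \<le> g v" using q[of v] y[of v] by (cases "v \<in> A") (auto simp: q_def)
  qed
  moreover have "active N g {y} = A"
    using q y AN by (force simp: active_def q_def)
  ultimately show ?thesis unfolding A_def by blast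
qed

text \<open>The facet-defining points move continuously with the right-hand side.\<close>

lemma facet_system_perturb:
  "\<exists>d>0. \<forall>g. (\<forall>u\<in>N. \<bar>g u - h u\<bar> < d) \<longrightarrow> facet_system N g"
proof -
  obtain X where X: "\<And>u. u \<in> N \<Longrightarrow> u \<bullet> X u = h u" "\<And>u v. u \<in> N \<Longrightarrow> v \<in> N - {u} \<Longrightarrow> v \<bullet> X u < h v"
    using facet_point by metis
  let ?S = "SIGMA u:N. N - {u}"
  have "\<exists>e>0. \<forall>p\<in>?S. e < h (snd p) - snd p \<bullet> X (fst p)"
    by (rule finite_positive_lower_bound) (auto simp: finite_N intro!: X(2))
  then obtain e where e: "e > 0" "\<And>u v. u \<in> N \<Longrightarrow> v \<in> N - {u} \<Longrightarrow> e < h v - v \<bullet> X u" by fastforce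
  have "facet_system N g" if g: "\<forall>u\<in>N. \<bar>g u - h u\<bar> < e / 2" for g
  proof
    show "bounded (hpoly N g)" by (rule bounded_hpoly_any_rhs)
    fix u assume u: "u \<in> N"
    have uu: "u \<bullet> u = 1" using norm_N[OF u] by (simp add: dot_square_norm)
    \<comment> \<open>The shift along \<open>u\<close> restores equality at \<open>u\<close>. For
      any other \<open>v\<close>, the shift and the change of right-hand side each cost less than
      \<open>e / 2\<close>.\<close>
    have "v \<bullet> (X u + (g u - h u) *\<^sub>R u) < g v" if v: "v \<in> N - {u}" for v
    proof -
      have "\<bar>v \<bullet> u\<bar> \<le> 1" using Cauchy_Schwarz_ineq2[of v u] norm_N[OF u] norm_N[of v] v by simp
      define p where "p = (g u - h u) * (v \<bullet> u)"
      have "\<bar>p\<bar> \<le> \<bar>g u - h u\<bar>"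
        unfolding p_def abs_mult using \<open>\<bar>v \<bullet> u\<bar> \<le> 1\<close> by (intro mult_left_le) auto
      moreover have "\<bar>g u - h u\<bar> < e / 2" "\<bar>g v - h v\<bar> < e / 2" using g u v by auto
      moreover have "v \<bullet> (X u + (g u - h u) *\<^sub>R u) = v \<bullet> X u + p"
        by (simp add: inner_add_right p_def)
      ultimately show ?thesis using e(2)[OF u v] by linarith
    qed
    then show "\<exists>x. u \<bullet> x = g u \<and> (\<forall>v\<in>N-{u}. v \<bullet> x < g v)"
      using X(1)[OF u] uu by (intro exI[of _ "X u + (g u - h u) *\<^sub>R u"]) (simp add: inner_add_right)
  qed (use finite_N norm_N in auto)
  then show ?thesis using e(1) half_gt_zero by blast
qed

end

text \<open>Normals are added one at a time. A new normal \<open>u\<close> in the span of earlier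
  ones is constant on their common points, so only finitely many values, one per subset, can create
  a dependence, and any interval contains others.\<close>

lemma generic_rhs:
  fixes N :: "(real^'n) set"
  assumes "finite N" "d > 0"
  shows "\<exists>g. (\<forall>u\<in>N. \<bar>g u - h u\<bar> < d) \<and> (\<forall>x. independent (active N g {x}))"
  using assms(1)
proof (induction N rule: finite_induct)
  case empty
  then show ?case by (auto simp: active_def independent_empty)
next
  case (insert u N)
  then obtain g where g: "\<forall>u\<in>N. \<bar>g u - h u\<bar> < d" "\<And>x. independent (active N g {x})" by blast
  have "\<exists>c. \<forall>x. (\<forall>b\<in>B. b \<bullet> x = g b) \<longrightarrow> u \<bullet> x = c" if "u \<in> span B" for B
  proof -
    obtain t r where "finite t" "t \<subseteq> B" "u = (\<Sum>a\<in>t. r a *\<^sub>R a)"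
      using \<open>u \<in> span B\<close> unfolding span_explicit by blast
    then have "\<forall>x. (\<forall>b\<in>B. b \<bullet> x = g b) \<longrightarrow> u \<bullet> x = (\<Sum>a\<in>t. r a * g a)"
      by (auto simp: inner_sum_left intro!: sum.cong)
    then show ?thesis by blast
  qed
  then obtain c where c: "\<And>B x. u \<in> span B \<Longrightarrow> (\<forall>b\<in>B. b \<bullet> x = g b) \<Longrightarrow> u \<bullet> x = c B"
    by metis
  have "infinite {h u - d<..<h u + d}" using assms(2) by (simp add: infinite_Ioo)
  moreover have "finite (c ` Pow N)" using insert by simp
  ultimately obtain k where k: "k \<in> {h u - d<..<h u + d}" "k \<notin> c ` Pow N"
    by (meson finite_subset subsetI)
  define g' where "g' = g(u := k)"
  have act: "active N g' F = active N g F" for F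
    unfolding active_def g'_def using insert by auto
  have "independent (active (insert u N) g' {x})" for x
  proof (cases "u \<bullet> x = k")
    case True
    have eq: "active (insert u N) g' {x} = insert u (active N g {x})"
      unfolding act[symmetric] using True by (auto simp: active_def g'_def)
    have "u \<notin> span (active N g {x})"
    proof
      assume "u \<in> span (active N g {x})"
      then have "u \<bullet> x = c (active N g {x})" by (rule c) (auto simp: active_def)
      moreover have "active N g {x} \<in> Pow N" by (auto simp: active_def)
      ultimately show False using k(2) True by blast
    qed
    then show ?thesis unfolding eq using g(2) by (simp add: independent_insertI)
  next
    case False
    then have "active (insert u N) g' {x} = active N g {x}"
      unfolding act[symmetric] by (auto simp: active_def g'_def)
    then show ?thesis using g(2) by simp
  qed
  moreover have "\<forall>v\<in>insert u N. \<bar>g' v - h v\<bar> < d"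
    using g(1) k(1) insert by (auto simp: g'_def)
  ultimately show ?case by blast
qed

text \<open>The right-hand side vanishes on \<open>A\<close>, so that all facets with normals in \<open>A\<close> pass through the
  origin; elsewhere it is the support function of the convex hull of finitely many small balls
  inside the polar cone of \<open>A\<close>. The balls make every normal outside \<open>A\<close> define a facet.\<close>

lemma (in facet_system) facet_system_with_common_point:
  assumes A: "A \<subseteq> N" "conical_position A" "\<And>u. u \<in> N - A \<Longrightarrow> u \<notin> pos A"
  obtains g where "facet_system N g" "0 \<in> hpoly N g" "A \<subseteq> active N g {0}"
proof -
  have finA: "finite A" using A(2) by (simp add: conical_position_def)
  obtain w where w: "\<And>v. v \<in> A \<Longrightarrow> v \<bullet> w < 0" using conical_position_neg_direction[OF A(2)] by blast
  have "\<exists>c. u \<bullet> c > 0 \<and> (\<forall>v\<in>A. v \<bullet> c < 0)" if u: "u \<in> N - A" for u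
  proof -
    obtain y where y: "u \<bullet> y > 0" "\<And>v. v \<in> A \<Longrightarrow> v \<bullet> y \<le> 0" 
      using farkas[OF finA A(3)[OF u]] by blast
    \<comment> \<open>Adding \<open>t *\<^sub>R w\<close> makes all of \<open>A\<close> strictly
      negative, and \<open>t\<close> is small enough for \<open>u\<close> to stay positive.\<close>
    define t where "t = (u \<bullet> y) / (\<bar>u \<bullet> w\<bar> + 1)"
    have t: "t > 0" using y by (simp add: t_def add_nonneg_pos)
    have "t * (\<bar>u \<bullet> w\<bar> + 1) = u \<bullet> y" unfolding t_def by (simp add: add_nonneg_eq_0_iff)
    moreover have "t * - (u \<bullet> w) \<le> t * \<bar>u \<bullet> w\<bar>" using t by (intro mult_left_mono) auto
    ultimately have "u \<bullet> (y + t *\<^sub>R w) > 0" using t by (simp add: inner_add_right algebra_simps)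
    moreover have "v \<bullet> (y + t *\<^sub>R w) < 0" if "v \<in> A" for v
      using y(2)[OF that] mult_pos_neg[OF t w[OF that]] by (simp add: inner_add_right)
    ultimately show ?thesis by blast
  qed
  then obtain c where c: "\<And>u. u \<in> N - A \<Longrightarrow> u \<bullet> c u > 0" "\<And>u v. u \<in> N - A \<Longrightarrow> v \<in> A \<Longrightarrow> v \<bullet> c u < 0"
    by metis
  have "\<exists>r>0. \<forall>p\<in>A \<times> (N - A). r < - (fst p \<bullet> c (snd p))"
    by (rule finite_positive_lower_bound) (use finA finite_N c(2) in auto)
  then obtain r where r0: "r > 0" "\<forall>p\<in>A \<times> (N - A). r < - (fst p \<bullet> c (snd p))" by blast
  have r: "v \<bullet> c u + r < 0" if "u \<in> N - A" "v \<in> A" for u v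
    using bspec[OF r0(2), of "(v, u)"] that by simp
  \<comment> \<open>\<open>m u + r\<close> is the support function of the union of the balls of
    radius \<open>r\<close> around the points \<open>c v\<close>. It is used only for
    \<open>u\<close> outside \<open>A\<close>, where the maximum is over a nonempty set.\<close>
  define m where "m u = Max ((\<lambda>v. u \<bullet> c v) ` (N - A))" for u
  define g where "g u = (if u \<in> A then 0 else m u + r)" for u
  have m: "u \<bullet> c v \<le> m u" if "v \<in> N - A" for u v
    unfolding m_def using finite_N that by (intro Max_ge) auto
  have gpos: "g u > 0" if "u \<in> N - A" for u
    using m[OF that, of u] c(1)[OF that] r0(1) that by (simp add: g_def)
  have "facet_system N g"
  proof
    show "bounded (hpoly N g)" by (rule bounded_hpoly_any_rhs)
    fix u assume u: "u \<in> N"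
    have uu: "u \<bullet> u = 1" using norm_N[OF u] by (simp add: dot_square_norm)
    show "\<exists>x. u \<bullet> x = g u \<and> (\<forall>v\<in>N-{u}. v \<bullet> x < g v)"
    proof (cases "u \<in> A")
      case True
      have "u \<notin> pos (A - {u})" using A(2) True by (simp add: conical_position_def)
      then obtain y where y: "u \<bullet> y > 0" "\<And>v. v \<in> A - {u} \<Longrightarrow> v \<bullet> y \<le> 0"
        using farkas[of "A - {u}" u] finA by blast
      \<comment> \<open>Chosen so that \<open>u\<close> vanishes at \<open>z\<close> while the rest
        of \<open>A\<close> is strictly negative; scaling by a small \<open>s\<close> then respects
        the normals outside \<open>A\<close>, where \<open>g\<close> is positive.\<close>
      define t where "t = (u \<bullet> y) / - (u \<bullet> w)"
      have t: "t > 0" unfolding t_def using y(1) w[OF True] by (intro divide_pos_pos) auto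
      define z where "z = y + t *\<^sub>R w"
      have uz: "u \<bullet> z = 0" using w[OF True] by (simp add: z_def t_def inner_add_right inner_diff_right)
      have vz: "v \<bullet> z < 0" if "v \<in> A - {u}" for v
        using y(2)[OF that] mult_pos_neg[OF t w[of v]] that by (simp add: z_def inner_add_right)
      have "\<exists>s>0. \<forall>v\<in>N - A. s < g v / (\<bar>v \<bullet> z\<bar> + 1)"
        by (rule finite_positive_lower_bound) (use finite_N gpos in \<open>auto simp: add_nonneg_pos\<close>)
      then obtain s where s: "s > 0" "\<And>v. v \<in> N - A \<Longrightarrow> s < g v / (\<bar>v \<bullet> z\<bar> + 1)" by blast
      have "v \<bullet> (s *\<^sub>R z) < g v" if v: "v \<in> N - {u}" for v
      proof (cases "v \<in> A")
        case True
        then show ?thesis using vz[of v] v s(1) by (simp add: g_def mult_pos_neg)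
      next
        case False
        then have "s * (\<bar>v \<bullet> z\<bar> + 1) < g v"
          using s(2)[of v] v by (simp add: pos_less_divide_eq add_nonneg_pos)
        moreover have "s * (v \<bullet> z) \<le> s * (\<bar>v \<bullet> z\<bar> + 1)" using s(1) by (intro mult_left_mono) auto
        ultimately show ?thesis by simp
      qed
      then show ?thesis using uz True by (intro exI[of _ "s *\<^sub>R z"]) (simp add: g_def)
    next
      case False
      then have uNA: "u \<in> N - A" using u by simp
      have "m u \<in> (\<lambda>v. u \<bullet> c v) ` (N - A)"
        unfolding m_def using finite_N uNA by (intro Max_in) auto
      then obtain v0 where v0: "v0 \<in> N - A" "m u = u \<bullet> c v0" by auto
      \<comment> \<open>The facet point is the extreme point in direction \<open>u\<close> of the
        ball whose center is farthest in that direction. Strictness holds because distinct unit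
        vectors have inner product below 1.\<close>
      have "v \<bullet> (c v0 + r *\<^sub>R u) < g v" if v: "v \<in> N - {u}" for v
      proof -
        have vv: "v \<bullet> v = 1" using norm_N v by (simp add: dot_square_norm)
        have "(u - v) \<bullet> (u - v) > 0" using v by auto
        then have "v \<bullet> u < 1" using uu vv by (simp add: inner_diff_left inner_diff_right inner_commute)
        then have lt: "r * (v \<bullet> u) < r" using r0(1) by simp
        show ?thesis
        proof (cases "v \<in> A")
          case True
          then show ?thesis using lt r[OF v0(1) True] by (simp add: g_def inner_add_right)
        next
          case False
          then show ?thesis using lt m[OF v0(1), of v] by (simp add: g_def inner_add_right)
        qed
      qed
      then show ?thesis using False uu v0(2)
        by (intro exI[of _ "c v0 + r *\<^sub>R u"]) (simp add: g_def inner_add_right)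
    qed
  qed (use finite_N norm_N in auto)
  moreover have "0 \<in> hpoly N g"
    using gpos by (force simp: hpoly_def g_def less_imp_le)
  moreover have "A \<subseteq> active N g {0}" using A(1) by (auto simp: active_def g_def)
  ultimately show ?thesis using that by blast
qed

section \<open>Vertex degrees as invariants of the face lattice\<close>

text \<open>Only inclusions between members of the family occur, so an order isomorphism transports
  the notion; the least element is described by lying below all members. \<open>coatom_in\<close> is
  the dual.\<close>

definition atom_in :: "'a set set \<Rightarrow> 'a set \<Rightarrow> bool" where
  "atom_in \<F> V \<longleftrightarrow> V \<in> \<F> \<and> (\<exists>G\<in>\<F>. \<not> V \<subseteq> G) \<and>
     (\<forall>G\<in>\<F>. G \<subseteq> V \<longrightarrow> V \<subseteq> G \<or> (\<forall>K\<in>\<F>. G \<subseteq> K))"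

definition coatom_in :: "'a set set \<Rightarrow> 'a set \<Rightarrow> bool" where
  "coatom_in \<F> F \<longleftrightarrow> F \<in> \<F> \<and> (\<exists>G\<in>\<F>. \<not> G \<subseteq> F) \<and>
     (\<forall>G\<in>\<F>. F \<subseteq> G \<longrightarrow> G \<subseteq> F \<or> (\<forall>K\<in>\<F>. K \<subseteq> G))"

text \<open>For the faces of a polytope this bounds the number of facets through each
  vertex.\<close>

definition degrees_le :: "'a set set \<Rightarrow> nat \<Rightarrow> bool" where
  "degrees_le \<F> k \<longleftrightarrow> (\<forall>V. atom_in \<F> V \<longrightarrow> card {F. coatom_in \<F> F \<and> V \<subseteq> F} \<le> k)"

lemma comb_equiv_degrees_le:
  assumes "comb_equiv P Q"
  shows "degrees_le {F. F face_of P} k \<longleftrightarrow> degrees_le {F. F face_of Q} k"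
proof -
  define \<F> where "\<F> = {F. F face_of P}"
  obtain f where "bij_betw f \<F> {G. G face_of Q}"
    and ord: "\<And>F G. F \<in> \<F> \<Longrightarrow> G \<in> \<F> \<Longrightarrow> f F \<subseteq> f G \<longleftrightarrow> F \<subseteq> G"
    using assms unfolding comb_equiv_def \<F>_def by blast
  then have inj: "inj_on f \<F>" and Q: "{G. G face_of Q} = f ` \<F>" by (auto simp: bij_betw_def)
  have atom: "atom_in (f ` \<F>) (f V) \<longleftrightarrow> atom_in \<F> V" if "V \<in> \<F>" for V
    using that by (simp add: atom_in_def ord inj_on_eq_iff[OF inj] cong: ball_cong bex_cong)
  have coatom: "coatom_in (f ` \<F>) (f V) \<longleftrightarrow> coatom_in \<F> V" if "V \<in> \<F>" for V
    using that by (simp add: coatom_in_def ord inj_on_eq_iff[OF inj] cong: ball_cong bex_cong)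
  have deg: "card {F. coatom_in (f ` \<F>) F \<and> f V \<subseteq> F} = card {F. coatom_in \<F> F \<and> V \<subseteq> F}"
    if V: "V \<in> \<F>" for V
  proof -
    have "{F. coatom_in (f ` \<F>) F \<and> f V \<subseteq> F} = f ` {F. coatom_in \<F> F \<and> V \<subseteq> F}"
    proof (intro equalityI subsetI)
      fix G assume "G \<in> {F. coatom_in (f ` \<F>) F \<and> f V \<subseteq> F}"
      then have G: "coatom_in (f ` \<F>) G" "f V \<subseteq> G" by auto
      then obtain F where "F \<in> \<F>" "G = f F" by (auto simp: coatom_in_def)
      then show "G \<in> f ` {F. coatom_in \<F> F \<and> V \<subseteq> F}" using G coatom ord V by blast
    next
      fix G assume "G \<in> f ` {F. coatom_in \<F> F \<and> V \<subseteq> F}"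
      then obtain F where F: "G = f F" "coatom_in \<F> F" "V \<subseteq> F" by auto
      then have "F \<in> \<F>" by (simp add: coatom_in_def)
      then show "G \<in> {F. coatom_in (f ` \<F>) F \<and> f V \<subseteq> F}" using F coatom ord V by blast
    qed
    moreover have "inj_on f {F. coatom_in \<F> F \<and> V \<subseteq> F}"
      by (rule inj_on_subset[OF inj]) (auto simp: coatom_in_def)
    ultimately show ?thesis by (simp add: card_image)
  qed
  have "degrees_le \<F> k \<longleftrightarrow> degrees_le (f ` \<F>) k"
  proof
    assume L: "degrees_le \<F> k"
    show "degrees_le (f ` \<F>) k"
      unfolding degrees_le_def
    proof (intro allI impI)
      fix W assume W: "atom_in (f ` \<F>) W"
      then obtain V where V: "V \<in> \<F>" "W = f V" by (auto simp: atom_in_def)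
      then have "card {F. coatom_in \<F> F \<and> V \<subseteq> F} \<le> k"
        using W L atom[OF V(1)] unfolding degrees_le_def by blast
      then show "card {F. coatom_in (f ` \<F>) F \<and> W \<subseteq> F} \<le> k"
        unfolding V(2) deg[OF V(1)] .
    qed
  next
    assume R: "degrees_le (f ` \<F>) k"
    show "degrees_le \<F> k"
      unfolding degrees_le_def
    proof (intro allI impI)
      fix V assume V: "atom_in \<F> V"
      then have VF: "V \<in> \<F>" by (simp add: atom_in_def)
      then have "card {F. coatom_in (f ` \<F>) F \<and> f V \<subseteq> F} \<le> k"
        using V R atom[OF VF] unfolding degrees_le_def by blast
      then show "card {F. coatom_in \<F> F \<and> V \<subseteq> F} \<le> k"
        unfolding deg[OF VF] .
    qed
  qed
  then show ?thesis unfolding Q \<F>_def[symmetric] .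
qed

section \<open>Vertices and facets inside the face lattice\<close>

context facet_system
begin

lemma face_exists_vertex:
  assumes F: "F face_of hpoly N h" "F \<noteq> {}"
  obtains x where "x extreme_point_of hpoly N h" "x \<in> F"
proof -
  have "compact F" "convex F"
    using F face_of_imp_compact face_of_imp_convex polytope_hpoly polytope_imp_compact polytope_imp_convex
    by metis+
  then show ?thesis
    using extreme_point_exists_convex F that extreme_point_of_face by metis
qed

text \<open>The empty face is the least element, and every nonempty face contains a vertex.\<close>

lemma atom_in_faces: "atom_in {F. F face_of hpoly N h} V \<longleftrightarrow> (\<exists>x. x extreme_point_of hpoly N h \<and> V = {x})"
proof
  assume V: "atom_in {F. F face_of hpoly N h} V"
  then have face: "V face_of hpoly N h" "V \<noteq> {}" by (auto simp: atom_in_def)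
  obtain x where x: "x extreme_point_of hpoly N h" "x \<in> V" using face_exists_vertex[OF face] .
  have "{x} face_of hpoly N h" using x(1) face_of_singleton by blast
  then have "V \<subseteq> {x} \<or> (\<forall>K\<in>{F. F face_of hpoly N h}. {x} \<subseteq> K)"
    using V x(2) unfolding atom_in_def by blast
  then have "V = {x}" using x(2) empty_face_of by blast
  then show "\<exists>x. x extreme_point_of hpoly N h \<and> V = {x}" using x by blast
next
  assume "\<exists>x. x extreme_point_of hpoly N h \<and> V = {x}"
  then obtain x where x: "{x} face_of hpoly N h" "V = {x}" using face_of_singleton by blast
  then show "atom_in {F. F face_of hpoly N h} V"
    unfolding atom_in_def using empty_face_of[of "hpoly N h"] by blast
qed

text \<open>Every proper face lies in some \<open>tight N h {u}\<close>. Conversely, the facet point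
  of \<open>u\<close> is on no other hyperplane, so a face containing this facet has at most
  \<open>u\<close> active.\<close>

lemma coatom_in_faces: "coatom_in {F. F face_of hpoly N h} F \<longleftrightarrow> (\<exists>u\<in>N. F = tight N h {u})"
proof
  have proper: "\<not> hpoly N h \<subseteq> tight N h {u}" if u: "u \<in> N" for u
  proof -
    obtain z where z: "\<forall>u\<in>N. u \<bullet> z < h u" using interior_point by auto
    then have "z \<in> hpoly N h" "z \<notin> tight N h {u}" using u by (auto simp: hpoly_def tight_def less_imp_le)
    then show ?thesis by blast
  qed
  have S: "hpoly N h face_of hpoly N h" by (rule face_of_refl[OF convex_hpoly])
  {
    assume F: "coatom_in {F. F face_of hpoly N h} F"
    then have face: "F face_of hpoly N h" by (simp add: coatom_in_def)
    have "F \<noteq> hpoly N h" using F face_of_imp_subset unfolding coatom_in_def by blast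
    then have "active N h F \<noteq> {}" using face_eq_tight[OF face] tight_empty by auto
    then obtain u where u: "u \<in> active N h F" by blast
    then have uN: "u \<in> N" by (simp add: active_def)
    have sub: "F \<subseteq> tight N h {u}"
      using u face_of_imp_subset[OF face] by (auto simp: active_def tight_def)
    have "tight N h {u} face_of hpoly N h" using tight_face[of "{u}"] uN by simp
    then have "tight N h {u} \<subseteq> F \<or> (\<forall>K\<in>{F. F face_of hpoly N h}. K \<subseteq> tight N h {u})"
      using F sub unfolding coatom_in_def by blast
    then have "F = tight N h {u}" using sub S proper[OF uN] by blast
    then show "\<exists>u\<in>N. F = tight N h {u}" using uN by blast
  next
    assume "\<exists>u\<in>N. F = tight N h {u}"
    then obtain u where u: "u \<in> N" "F = tight N h {u}" by blast
    have face: "F face_of hpoly N h" using tight_face[of "{u}"] u by simp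
    obtain x where x: "u \<bullet> x = h u" "\<forall>v\<in>N-{u}. v \<bullet> x < h v" using facet_point[OF u(1)] by auto
    have "v \<bullet> x \<le> h v" if "v \<in> N" for v using x that by (cases "v = u") (auto simp: less_imp_le)
    then have xF: "x \<in> F" using x by (auto simp: u(2) tight_def hpoly_def)
    have "G \<subseteq> F \<or> (\<forall>K\<in>{F. F face_of hpoly N h}. K \<subseteq> G)" if G: "G face_of hpoly N h" "F \<subseteq> G" for G
    proof (cases "active N h G = {}")
      case True
      then have "G = hpoly N h" using face_eq_tight[OF G(1)] tight_empty by simp
      then show ?thesis using face_of_imp_subset by blast
    next
      case False
      then obtain v where v: "v \<in> N" "\<forall>y\<in>G. v \<bullet> y = h v" by (auto simp: active_def)
      then have "v \<bullet> x = h v" using xF G(2) by blast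
      then have "v = u" using x(2) v(1) by force
      then have "G \<subseteq> F" using v(2) face_of_imp_subset[OF G(1)] by (auto simp: u(2) tight_def)
      then show ?thesis by simp
    qed
    then show "coatom_in {F. F face_of hpoly N h} F"
      unfolding coatom_in_def using face S proper[OF u(1)] u(2) by blast
  }
qed

text \<open>Facet points show that distinct normals give distinct facets, so counting facets through
  \<open>x\<close> is counting normals active at \<open>x\<close>.\<close>

lemma degrees_le_faces:
  "degrees_le {F. F face_of hpoly N h} k \<longleftrightarrow>
    (\<forall>x. x extreme_point_of hpoly N h \<longrightarrow> card (active N h {x}) \<le> k)"
proof -
  have "card {F. coatom_in {F. F face_of hpoly N h} F \<and> {x} \<subseteq> F} = card (active N h {x})"
    if x: "x extreme_point_of hpoly N h" for x
  proof -
    have xS: "x \<in> hpoly N h" using x by (simp add: extreme_point_of_def)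
    have "{F. coatom_in {F. F face_of hpoly N h} F \<and> {x} \<subseteq> F} = (\<lambda>u. tight N h {u}) ` active N h {x}"
      unfolding coatom_in_faces using xS by (auto simp: active_def tight_def)
    moreover have "inj_on (\<lambda>u. tight N h {u}) (active N h {x})"
    proof (rule inj_onI)
      fix u v assume uv: "u \<in> active N h {x}" "v \<in> active N h {x}" "tight N h {u} = tight N h {v}"
      then have uN: "u \<in> N" "v \<in> N" by (auto simp: active_def)
      obtain y where y: "u \<bullet> y = h u" "\<forall>v\<in>N-{u}. v \<bullet> y < h v" using facet_point[OF uN(1)] by auto
      have "w \<bullet> y \<le> h w" if "w \<in> N" for w using y that by (cases "w = u") (auto simp: less_imp_le)
      then have "y \<in> tight N h {u}" using y(1) by (auto simp: tight_def hpoly_def)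
      then have "v \<bullet> y = h v" unfolding uv(3) by (auto simp: tight_def)
      then show "u = v" using y(2) uN by force
    qed
    ultimately show ?thesis by (simp add: card_image)
  qed
  moreover have "degrees_le {F. F face_of hpoly N h} k \<longleftrightarrow> (\<forall>x. x extreme_point_of hpoly N h \<longrightarrow>
      card {F. coatom_in {F. F face_of hpoly N h} F \<and> {x} \<subseteq> F} \<le> k)"
    unfolding degrees_le_def atom_in_faces by blast
  ultimately show ?thesis by simp
qed

end

theorem theorem1p1:
  fixes P :: "(real^'n) set"
  assumes "polytope P" and "aff_dim P = int CARD('n)"
  shows "monotypic P \<longleftrightarrow>
    (\<forall>A. A \<subseteq> facet_normals P \<and> card A = CARD('n) + 1 \<and> conical_position A
       \<longrightarrow> (\<exists>u \<in> facet_normals P - A. u \<in> pos A))"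
proof -
  define N where "N = facet_normals P"
  obtain h where h: "facet_system N h" "P = hpoly N h"
    using facet_system_facet_normals[OF assms] unfolding N_def .
  interpret facet_system N h by (rule h(1))
  show ?thesis
    unfolding N_def[symmetric]
  proof
    assume mono: "monotypic P"
    have equiv: "comb_equiv P (hpoly N g)" if "facet_system N g" for g
      using mono facet_system.polytope_hpoly[OF that] facet_system.facet_normals_hpoly[OF that]
      unfolding monotypic_def N_def by simp
    obtain d where d: "d > 0" "\<And>g. \<forall>u\<in>N. \<bar>g u - h u\<bar> < d \<Longrightarrow> facet_system N g"
      using facet_system_perturb by blast
    \<comment> \<open>A small generic change of \<open>h\<close> gives a simple polytope with the
      same normals; monotypy carries its degree bound over to \<open>P\<close> and then to every
      other admissible polytope.\<close>
    obtain k where k: "\<forall>u\<in>N. \<bar>k u - h u\<bar> < d" "\<And>x. independent (active N k {x})"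
      using generic_rhs[OF finite_N d(1)] by blast
    have "card (active N k {x}) \<le> CARD('n)" for x
      using independent_bound[OF k(2)] by simp
    then have "degrees_le {F. F face_of hpoly N k} CARD('n)"
      using facet_system.degrees_le_faces[OF d(2)[OF k(1)]] by blast
    then have degP: "degrees_le {F. F face_of P} CARD('n)"
      using comb_equiv_degrees_le[OF equiv[OF d(2)[OF k(1)]]] by blast
    show "\<forall>A. A \<subseteq> N \<and> card A = CARD('n) + 1 \<and> conical_position A \<longrightarrow> (\<exists>u \<in> N - A. u \<in> pos A)"
    proof (intro allI impI, elim conjE, rule ccontr)
      fix A assume A: "A \<subseteq> N" "card A = CARD('n) + 1" "conical_position A" "\<not> (\<exists>u \<in> N - A. u \<in> pos A)"
      obtain g where g: "facet_system N g" "0 \<in> hpoly N g" "A \<subseteq> active N g {0}"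
        using facet_system_with_common_point[OF A(1,3)] A(4) by blast
      interpret g: facet_system N g by (rule g(1))
      have "0 \<in> tight N g A" using g(2,3) by (auto simp: tight_def active_def)
      \<comment> \<open>The origin is not known to be a vertex, but the face
        \<open>tight N g A\<close> through it has one, and there all of \<open>A\<close> is
        active.\<close>
      then obtain x where x: "x extreme_point_of hpoly N g" "x \<in> tight N g A"
        using g.face_exists_vertex[OF g.tight_face[OF A(1)]] by blast
      have "A \<subseteq> active N g {x}" using x(2) A(1) by (auto simp: tight_def active_def)
      then have "CARD('n) + 1 \<le> card (active N g {x})"
        using card_mono[OF g.finite_active] A(2) by metis
      moreover have "degrees_le {F. F face_of hpoly N g} CARD('n)"
        using degP comb_equiv_degrees_le[OF equiv[OF g(1)]] by blast
      ultimately show False using x(1) g.degrees_le_faces by fastforce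
    qed
  next
    assume cond: "\<forall>A. A \<subseteq> N \<and> card A = CARD('n) + 1 \<and> conical_position A \<longrightarrow> (\<exists>u \<in> N - A. u \<in> pos A)"
    have simple: "card (active N g {x}) \<le> CARD('n)" if "facet_system N g" "x \<in> hpoly N g" for g x
      using facet_system.card_active_le[OF that(1) cond that(2)] .
    show "monotypic P"
      unfolding monotypic_def
    proof (intro allI impI, elim conjE)
      fix Q :: "(real^'n) set" assume Q: "polytope Q" "facet_normals Q = facet_normals P"
      then have QN: "facet_normals Q = N" by (simp add: N_def)
      \<comment> \<open>Monotypy also admits lower-dimensional \<open>Q\<close>; the finite nonempty
        set of normals excludes these.\<close>
      have "aff_dim Q = int CARD('n)"
        by (rule aff_dim_eq_if_finite_facet_normals) (use QN finite_N N_nonempty in auto)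
      then obtain g where g: "facet_system N g" "Q = hpoly N g"
        using facet_system_facet_normals[OF Q(1)] unfolding QN by blast
      show "comb_equiv P Q"
        unfolding h(2) g(2)
        by (rule comb_equiv_if_same_active_sets[OF h(1) g(1)])
          (use active_set_persists[OF simple g(1)] facet_system.active_set_persists[OF g(1) simple h(1)]
            in blast)+
    qed
  qed
qed

end
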